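(* Consider the problem $\min_{x\in\mathbb{R}^d} H(x)+F(Ax)$ with $H=\frac1n\sum_{i=1}^n H_i$ and $A:\mathbb{R}^d\to\mathbb{R}^m$ linear, and suppose that: (1) $F:\mathbb{R}^m\to\mathbb{R}\cup\{+\infty\}$ and $H:\mathbb{R}^d\to\mathbb{R}$ are proper, lower semicontinuous and bounded from below; (2) $A$ is surjective; (3) each $H_i$ is differentiable and there is $L>0$ with $\|\nabla H_i(x)-\nabla H_i(y)\|\le L\|x-y\|$ for all $x,y\in\mathbb{R}^d$ and all $i$. Let $\beta,\tau>0$ and $0<\sigma\le 1$ with $2\tau\ge\beta\|A\|^2$. Let $\{(x_t,z_t,u_t)\}_{t\ge0}$ be a sequence generated by the stochastic ADMM algorithm (described in the context) using a variance-reduced gradient estimator $\widetilde\nabla H$ with constants $V_1,V_2,V_\Upsilon\ge0$, $\rho\in(0,1]$ and associated sequence $\{\Upsilon_t\}_{t\ge1}$ (as defined in the context). Let $\eta>0$ and $C_2>0$ be constants, and define for $t\ge1$ the stability function $$\Psi_t=\mathcal{L}_\beta(x_t,z_t,u_t)+C_0\|A^T(u_t-u_{t-1})+\sigma B(x_t-x_{t-1})\|^2+\frac1\rho\Big(\frac{32}{\sigma\beta\lambda_m}+\frac{\eta}{2}\Big)\Upsilon_t+\frac{16}{\sigma\beta\lambda_m}\|\widetilde\nabla H(x_{t-1})-\nabla H(x_{t-1})\|^2+C_3\|x_t-x_{t-1}\|^2,$$ where $\lambda_m$ is the smallest eigenvalue of $AA^T$, $B=\tau\,\mathrm{Id}-\beta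 A^TA$, $C_0=\frac{4(1-\sigma)}{\sigma^2\beta\lambda_m}\ge 0$, $C_1=\frac{8(\sigma\tau+L)^2}{\sigma\beta\lambda_m}$ and $C_3=\big(\frac{32}{\sigma\beta\lambda_m}+\frac\eta2\big)\big(V_1+\frac{V_\Upsilon}{\rho}\big)+C_2+C_1$. Then for every $t\ge1$, $$\mathbb{E}_t\Big[\Psi_{t+1}+\tilde\eta\|x_{t+1}-x_t\|^2+C_2\|x_t-x_{t-1}\|^2+\frac{1}{\sigma\beta}\|u_{t+1}-u_t\|^2\Big]\le\Psi_t,$$ where $$\tilde\eta=\tau-\frac{L+\beta\|A\|^2}{2}-\frac{4\sigma\tau^2}{\beta\lambda_m}-\frac{8(\sigma\tau+L)^2}{\sigma\beta\lambda_m}-\frac{1}{2\eta}-\Big(\frac{64}{\sigma\beta\lambda_m}+\eta\Big)\Big(V_1+\frac{V_\Upsilon}{\rho}\Big)-C_2.$$ Moreover, if $\tilde\eta>0$, then $$\sum_{t=0}^\infty\mathbb{E}\big[\|x_{t+1}-x_t\|^2+\|u_{t+1}-u_t\|^2+\|z_{t+1}-z_t\|^2\big]<+\infty.$$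
   Context: Augmented Lagrangian: $\mathcal{L}_\beta(x,z,u)=F(z)+H(x)+\langle u,Ax-z\rangle+\frac\beta2\|Ax-z\|^2$. Stochastic ADMM algorithm: given an initialization and parameters $\beta,\tau,\sigma>0$, for $t=0,1,2,\dots$ $$z_{t+1}\in\arg\min_z\ F(z)+\langle u_t,Ax_t-z\rangle+\tfrac\beta2\|Ax_t-z\|^2,$$ $$x_{t+1}=x_t-\tfrac1\tau\big(\widetilde\nabla H(x_t)+A^Tu_t+\beta A^T(Ax_t-z_{t+1})\big),$$ $$u_{t+1}=u_t+\sigma\beta(Ax_{t+1}-z_{t+1}),$$ where $\widetilde\nabla H(x_t)$ is a random approximation of $\nabla H(x_t)$ computed at iteration $t+1$. $\mathbb{E}_t$ denotes expectation conditional on the first $t$ iterations of the algorithm (so $x_t,z_t,u_t$, $\widetilde\nabla H(x_{t-1})$ and $\Upsilon_t$ are known), and $\mathbb{E}$ the full expectation. Variance-reduced gradient estimator: $\widetilde\nabla$ is called variance-reduced if there are constants $V_1,V_2,V_\Upsilon\ge0$ and $\rho\in(0,1]$ such that: 1. (MSE bound) there is a sequence of random variables $\{\Upsilon_t\}_{t\ge1}$ of the form $\Upsilon_t=\sum_{i=1}^s\|v_t^i\|^2$ for some random vectors $v_t^i$ such that $\mathbb{E}_t\|\widetilde\nabla H(x_t)-\nabla H(x_t)\|^2\le\Upsilon_t+V_1(\mathbb{E}_t\|x_{t+1}-x_t\|^2+\|x_t-x_{t-1}\|^2)$, and, with $\Gamma_t=\sum_{i=1}^s\|v_t^i\|$,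 $\mathbb{E}_t\|\widetilde\nabla H(x_t)-\nabla H(x_t)\|\le\Gamma_t+V_2(\mathbb{E}_t\|x_{t+1}-x_t\|+\|x_t-x_{t-1}\|)$; 2. (Geometric decay) $\mathbb{E}_t\Upsilon_{t+1}\le(1-\rho)\Upsilon_t+V_\Upsilon(\mathbb{E}_t\|x_{t+1}-x_t\|^2+\|x_t-x_{t-1}\|^2)$; 3. (Convergence of estimator) for all sequences $\{x_t\}$ with $\lim_{t\to\infty}\mathbb{E}\|x_t-x_{t-1}\|^2=0$ one has $\mathbb{E}\Upsilon_t\to0$ and $\mathbb{E}\Gamma_t\to0$. *)

theory Defs
  imports "HOL-Probability.Probability"
begin

definition proper_fun :: "('x \<Rightarrow> ereal) \<Rightarrow> bool" where
  "proper_fun f \<longleftrightarrow> (\<exists>x. f x < \<infinity>) \<and> (\<forall>x. - \<infinity> < f x)"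

definition lower_semicont :: "('x::topological_space \<Rightarrow> ereal) \<Rightarrow> bool" where
  "lower_semicont f \<longleftrightarrow> (\<forall>x. f x \<le> Liminf (at x) f)"

definition bounded_from_below :: "('x \<Rightarrow> ereal) \<Rightarrow> bool" where
  "bounded_from_below f \<longleftrightarrow> (\<exists>c::real. \<forall>x. ereal c \<le> f x)"

definition grad :: "('x::real_inner \<Rightarrow> real) \<Rightarrow> 'x \<Rightarrow> 'x" where
  "grad f x = (THE D. GDERIV f x :> D)"

definition is_eigenvalue :: "real^'k^'k \<Rightarrow> real \<Rightarrow> bool" where
  "is_eigenvalue C l \<longleftrightarrow> (\<exists>v. v \<noteq> 0 \<and> C *v v = l *\<^sub>R v)"

text \<open>Meaningful for matrices having a least real eigenvalue, in particular symmetric ones.\<close>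

definition smallest_eigenvalue :: "real^'k^'k \<Rightarrow> real" where
  "smallest_eigenvalue C = (LEAST l. is_eigenvalue C l)"

definition aug_lagrangian ::
  "(real^'m \<Rightarrow> ereal) \<Rightarrow> (real^'d \<Rightarrow> real) \<Rightarrow> real^'d^'m \<Rightarrow> real
    \<Rightarrow> real^'d \<Rightarrow> real^'m \<Rightarrow> real^'m \<Rightarrow> ereal" where
  "aug_lagrangian F H A \<beta> x z u =
     F z + ereal (H x + u \<bullet> (A *v x - z) + \<beta> / 2 * (norm (A *v x - z))\<^sup>2)"

text \<open>
  \<open>Fil t\<close> is the \<open>\<sigma>\<close>-algebra of events known after the first \<open>t\<close> iterations, so that the
  conditional expectation \<open>E\<^sub>t\<close> is \<open>real_cond_exp M (Fil t)\<close>.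
\<close>

definition adapted :: "(nat \<Rightarrow> 'w measure) \<Rightarrow> (nat \<Rightarrow> 'w \<Rightarrow> 'x::topological_space) \<Rightarrow> bool" where
  "adapted Fil X \<longleftrightarrow> (\<forall>t. X t \<in> borel_measurable (Fil t))"

definition sq_integrable :: "'w measure \<Rightarrow> ('w \<Rightarrow> 'x::real_normed_vector) \<Rightarrow> bool" where
  "sq_integrable M X \<longleftrightarrow> X \<in> borel_measurable M \<and> integrable M (\<lambda>\<omega>. (norm (X \<omega>))\<^sup>2)"

text \<open>
  A gradient estimator is a map \<open>g\<close> on processes: \<open>g t X\<close> is the random vector approximating
  \<open>grad H (X t)\<close> along the random sequence \<open>X\<close>. It is drawn during iteration \<open>t + 1\<close>, whence
  the index shift in the measurability condition. Having \<open>X\<close> as an argument is what gives meaning to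
  quantifying over all sequences in the definition of variance reduction.
\<close>

type_synonym ('w, 'x, 'y) process_map = "(nat \<Rightarrow> 'w \<Rightarrow> 'x) \<Rightarrow> 'w \<Rightarrow> 'y"

definition gradient_estimator ::
  "(nat \<Rightarrow> 'w measure) \<Rightarrow> (nat \<Rightarrow> ('w, real^'d, real^'d) process_map) \<Rightarrow> bool" where
  "gradient_estimator Fil g \<longleftrightarrow>
     (\<forall>X. adapted Fil X \<longrightarrow> (\<forall>t. g t X \<in> borel_measurable (Fil (Suc t))))"

definition Upsilon ::
  "nat \<Rightarrow> (nat \<Rightarrow> nat \<Rightarrow> ('w, 'x, 'v::real_normed_vector) process_map)
    \<Rightarrow> (nat \<Rightarrow> 'w \<Rightarrow> 'x) \<Rightarrow> nat \<Rightarrow> 'w \<Rightarrow> real" where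
  "Upsilon s v X t \<omega> = (\<Sum>i=1..s. (norm (v t i X \<omega>))\<^sup>2)"

definition Gam ::
  "nat \<Rightarrow> (nat \<Rightarrow> nat \<Rightarrow> ('w, 'x, 'v::real_normed_vector) process_map)
    \<Rightarrow> (nat \<Rightarrow> 'w \<Rightarrow> 'x) \<Rightarrow> nat \<Rightarrow> 'w \<Rightarrow> real" where
  "Gam s v X t \<omega> = (\<Sum>i=1..s. norm (v t i X \<omega>))"

text \<open>
  The iteration. The expectations in the analysis only exist under second-moment conditions, which
  are imposed here on the initialization and on the estimated gradients.
\<close>

definition stochastic_admm ::
  "'w measure \<Rightarrow> (nat \<Rightarrow> 'w measure) \<Rightarrow> (real^'m \<Rightarrow> ereal) \<Rightarrow> real^'d^'m
    \<Rightarrow> real \<Rightarrow> real \<Rightarrow> real \<Rightarrow> (nat \<Rightarrow> ('w, real^'d, real^'d) process_map)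
    \<Rightarrow> (nat \<Rightarrow> 'w \<Rightarrow> real^'d) \<Rightarrow> (nat \<Rightarrow> 'w \<Rightarrow> real^'m) \<Rightarrow> (nat \<Rightarrow> 'w \<Rightarrow> real^'m) \<Rightarrow> bool" where
  "stochastic_admm M Fil F A \<beta> \<tau> \<sigma> g x z u \<longleftrightarrow>
     adapted Fil x \<and> adapted Fil z \<and> adapted Fil u \<and>
     sq_integrable M (x 0) \<and> sq_integrable M (z 0) \<and> sq_integrable M (u 0) \<and>
     (\<forall>t. sq_integrable M (g t x)) \<and>
     (\<forall>t. \<forall>\<omega>\<in>space M.
        is_arg_min
          (\<lambda>\<zeta>. F \<zeta> + ereal (u t \<omega> \<bullet> (A *v x t \<omega> - \<zeta>) + \<beta> / 2 * (norm (A *v x t \<omega> - \<zeta>))\<^sup>2))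
          (\<lambda>_. True) (z (Suc t) \<omega>) \<and>
        x (Suc t) \<omega> = x t \<omega> - (1 / \<tau>) *\<^sub>R
          (g t x \<omega> + transpose A *v u t \<omega>
            + \<beta> *\<^sub>R (transpose A *v (A *v x t \<omega> - z (Suc t) \<omega>))) \<and>
        u (Suc t) \<omega> = u t \<omega> + (\<sigma> * \<beta>) *\<^sub>R (A *v x (Suc t) \<omega> - z (Suc t) \<omega>))"

text \<open>
  The mean-squared-error bounds and the geometric decay are required along the iterates \<open>x\<close>, the
  convergence of the estimator along every adapted square-integrable sequence. In the latter the
  expectations of the nonnegative variables are Lebesgue integrals with values in \<open>[0,\<infinity>]\<close>.
\<close>

definition variance_reduced ::
  "'w measure \<Rightarrow> (nat \<Rightarrow> 'w measure) \<Rightarrow> (real^'d \<Rightarrow> real)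
    \<Rightarrow> (nat \<Rightarrow> ('w, real^'d, real^'d) process_map)
    \<Rightarrow> nat \<Rightarrow> (nat \<Rightarrow> nat \<Rightarrow> ('w, real^'d, 'v::euclidean_space) process_map)
    \<Rightarrow> real \<Rightarrow> real \<Rightarrow> real \<Rightarrow> real \<Rightarrow> (nat \<Rightarrow> 'w \<Rightarrow> real^'d) \<Rightarrow> bool" where
  "variance_reduced M Fil H g s v V\<^sub>1 V\<^sub>2 V\<^sub>\<Upsilon> \<rho> x \<longleftrightarrow>
     gradient_estimator Fil g \<and>
     (\<forall>X. adapted Fil X \<longrightarrow> (\<forall>t\<ge>1. \<forall>i\<in>{1..s}. v t i X \<in> borel_measurable (Fil t))) \<and>
     (\<forall>t\<ge>1. \<forall>i\<in>{1..s}. sq_integrable M (v t i x)) \<and>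
     0 \<le> V\<^sub>1 \<and> 0 \<le> V\<^sub>2 \<and> 0 \<le> V\<^sub>\<Upsilon> \<and> 0 < \<rho> \<and> \<rho> \<le> 1 \<and>
     (\<forall>t\<ge>1. AE \<omega> in M.
        real_cond_exp M (Fil t) (\<lambda>\<omega>. (norm (g t x \<omega> - grad H (x t \<omega>)))\<^sup>2) \<omega>
        \<le> Upsilon s v x t \<omega>
          + V\<^sub>1 * (real_cond_exp M (Fil t) (\<lambda>\<omega>. (norm (x (t + 1) \<omega> - x t \<omega>))\<^sup>2) \<omega>
                  + (norm (x t \<omega> - x (t - 1) \<omega>))\<^sup>2)) \<and>
     (\<forall>t\<ge>1. AE \<omega> in M.
        real_cond_exp M (Fil t) (\<lambda>\<omega>. norm (g t x \<omega> - grad H (x t \<omega>))) \<omega>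
        \<le> Gam s v x t \<omega>
          + V\<^sub>2 * (real_cond_exp M (Fil t) (\<lambda>\<omega>. norm (x (t + 1) \<omega> - x t \<omega>)) \<omega>
                  + norm (x t \<omega> - x (t - 1) \<omega>))) \<and>
     (\<forall>t\<ge>1. AE \<omega> in M.
        real_cond_exp M (Fil t) (Upsilon s v x (t + 1)) \<omega>
        \<le> (1 - \<rho>) * Upsilon s v x t \<omega>
          + V\<^sub>\<Upsilon> * (real_cond_exp M (Fil t) (\<lambda>\<omega>. (norm (x (t + 1) \<omega> - x t \<omega>))\<^sup>2) \<omega>
                  + (norm (x t \<omega> - x (t - 1) \<omega>))\<^sup>2)) \<and>
     (\<forall>X. adapted Fil X \<and> (\<forall>t. sq_integrable M (X t)) \<and>
          (\<lambda>t. \<integral>\<omega>. (norm (X (t + 1) \<omega> - X t \<omega>))\<^sup>2 \<partial>M) \<longlonglongrightarrow> 0 \<longrightarrow>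
          (\<lambda>t. \<integral>\<^sup>+\<omega>. ennreal (Upsilon s v X t \<omega>) \<partial>M) \<longlonglongrightarrow> 0 \<and>
          (\<lambda>t. \<integral>\<^sup>+\<omega>. ennreal (Gam s v X t \<omega>) \<partial>M) \<longlonglongrightarrow> 0)"

end

theory Submission
  imports Defs
begin

text \<open>
  The updates of \<open>x\<close> and \<open>u\<close> combine to \<open>A\<^sup>T(u\<^sub>t\<^sub>+\<^sub>1 - u\<^sub>t) + \<sigma>B(x\<^sub>t\<^sub>+\<^sub>1 - x\<^sub>t) = - \<sigma>(A\<^sup>Tu\<^sub>t + g\<^sub>t)\<close>. Calling this
  vector \<open>w\<^sub>t\<close>, it follows that \<open>w\<^sub>t\<^sub>+\<^sub>1\<close> is the convex combination of \<open>w\<^sub>t\<close> and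
  \<open>\<sigma>B(x\<^sub>t\<^sub>+\<^sub>1 - x\<^sub>t) - (g\<^sub>t\<^sub>+\<^sub>1 - g\<^sub>t)\<close> with weights \<open>1 - \<sigma>\<close> and \<open>\<sigma>\<close>. Since \<open>\<parallel>B\<parallel> \<le> \<tau>\<close> and \<open>\<nabla>H\<close> is Lipschitz,
  this controls \<open>\<parallel>w\<^sub>t\<^sub>+\<^sub>1\<parallel>\<close>, and with it the increase \<open>\<parallel>u\<^sub>t\<^sub>+\<^sub>1 - u\<^sub>t\<parallel>\<^sup>2 / (\<sigma>\<beta>)\<close> of the Lagrangian in the dual
  step, because \<open>\<parallel>A\<^sup>Tq\<parallel>\<^sup>2 \<ge> \<lambda>\<^sub>m\<parallel>q\<parallel>\<^sup>2\<close>. The primal steps decrease the Lagrangian by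
  the descent lemma, up to the estimation error, whose conditional expectation the variance
  reduction absorbs into \<open>\<Upsilon>\<close>. For the summability, the expectations of \<open>\<Psi>\<^sub>t\<close> decrease and are
  bounded below: \<open>\<Psi>\<^sub>t\<close> is at least a constant plus \<open>(\<parallel>u\<^sub>t\<parallel>\<^sup>2 - \<parallel>u\<^sub>t\<^sub>-\<^sub>1\<parallel>\<^sup>2) / (2\<sigma>\<beta>)\<close>, and the sums of the
  latter telescope.
\<close>

text \<open>Strict superlevel sets are open, and these generate the Borel structure of
  \<open>ereal\<close>. The lemma makes \<open>F\<close> along the iterates a random
  variable.\<close>

lemma lower_semicont_borel_measurable:
  fixes f :: "'x::topological_space \<Rightarrow> ereal"
  assumes "lower_semicont f"
  shows "f \<in> borel_measurable borel"
proof (rule borel_measurableI_greater)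
  fix c
  have "open {x. c < f x}"
  proof (rule topological_space_class.openI)
    fix x assume "x \<in> {x. c < f x}"
    then have c: "c < f x" and "c < Liminf (at x) f"
      using assms by (auto simp: lower_semicont_def intro: less_le_trans)
    \<comment> \<open>\<open>Liminf (at x)\<close> sees only punctured neighbourhoods; the point
      \<open>x\<close> itself is covered by \<open>c < f x\<close>.\<close>
    then have "eventually (\<lambda>y. c < f y) (nhds x)"
      using less_LiminfD by (auto simp: eventually_nhds_conv_at)
    then show "\<exists>T. open T \<and> x \<in> T \<and> T \<subseteq> {x. c < f x}"
      by (auto simp: eventually_nhds)
  qed
  then show "{x \<in> space borel. c < f x} \<in> sets borel"
    by simp
qed

section \<open>Gradients\<close>

lemma grad_eqI:
  assumes "GDERIV f x :> D"
  shows "grad f x = D"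
  unfolding grad_def
proof (rule the_equality)
  fix E assume "GDERIV f x :> E"
  then have "(\<lambda>h. h \<bullet> E) = (\<lambda>h. h \<bullet> D)"
    using assms unfolding gderiv_def by (rule has_derivative_unique)
  then show "E = D"
    by (metis vector_eq_ldot)
qed (fact assms)

text \<open>Riesz representation in finite dimension: the vector representing the derivative
  \<open>f'\<close> is \<open>adjoint f' 1\<close>.\<close>

lemma GDERIV_grad:
  fixes f :: "'x::euclidean_space \<Rightarrow> real"
  assumes "f differentiable at x"
  shows "GDERIV f x :> grad f x"
proof -
  obtain f' where f': "(f has_derivative f') (at x)"
    using assms by (auto simp: differentiable_def)
  have "f' h = h \<bullet> adjoint f' 1" for h
    using adjoint_works[OF has_derivative_linear[OF f'], of h 1] by simp
  then have "f' = (\<lambda>h. h \<bullet> adjoint f' 1)"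
    by blast
  then have "GDERIV f x :> adjoint f' 1"
    using f' unfolding gderiv_def by metis
  then show ?thesis
    using grad_eqI by metis
qed

lemma GDERIV_average:
  fixes f :: "nat \<Rightarrow> 'x::euclidean_space \<Rightarrow> real"
  assumes "\<And>i. i \<in> {1..n} \<Longrightarrow> f i differentiable at a"
    and "\<And>a. h a = (1 / real n) * (\<Sum>i=1..n. f i a)"
  shows "GDERIV h a :> (1 / real n) *\<^sub>R (\<Sum>i=1..n. grad (f i) a)"
proof -
  have "((\<lambda>b. (1 / real n) * (\<Sum>i=1..n. f i b)) has_derivative
      (\<lambda>k. (1 / real n) * (\<Sum>i=1..n. k \<bullet> grad (f i) a))) (at a)"
    using GDERIV_grad assms(1) unfolding gderiv_def
    by (intro has_derivative_mult_right has_derivative_sum) auto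
  moreover have "h = (\<lambda>b. (1 / real n) * (\<Sum>i=1..n. f i b))"
    using assms(2) by blast
  ultimately show ?thesis
    by (simp add: gderiv_def inner_sum_right)
qed

lemma grad_average_Lipschitz:
  fixes f :: "nat \<Rightarrow> 'x::euclidean_space \<Rightarrow> real"
  assumes n: "n \<ge> 1"
    and diff: "\<And>i a. i \<in> {1..n} \<Longrightarrow> f i differentiable at a"
    and lip: "\<And>i a b. i \<in> {1..n} \<Longrightarrow> norm (grad (f i) a - grad (f i) b) \<le> L * norm (a - b)"
    and h: "\<And>a. h a = (1 / real n) * (\<Sum>i=1..n. f i a)"
  shows "norm (grad h a - grad h b) \<le> L * norm (a - b)"
proof -
  have "grad h a = (1 / real n) *\<^sub>R (\<Sum>i=1..n. grad (f i) a)" for a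
    using GDERIV_average[of n f a h] diff h grad_eqI by blast
  then have "norm (grad h a - grad h b)
      = (1 / real n) * norm (\<Sum>i=1..n. grad (f i) a - grad (f i) b)"
    by (simp flip: scaleR_diff_right sum_subtractf)
  also have "\<dots> \<le> (1 / real n) * (\<Sum>i=1..n. L * norm (a - b))"
    using lip by (intro mult_left_mono sum_norm_le) auto
  also have "\<dots> = L * norm (a - b)"
    using n by simp
  finally show ?thesis .
qed

text \<open>The gap between \<open>h\<close> and its quadratic upper model is nonincreasing along
  the segment from \<open>a\<close> to \<open>b\<close>, so monotonicity in one variable replaces
  integration of the gradient.\<close>

lemma descent_lemma:
  fixes h :: "'x::euclidean_space \<Rightarrow> real"
  assumes deriv: "\<And>a. GDERIV h a :> grad h a"
    and lip: "\<And>a b. norm (grad h a - grad h b) \<le> L * norm (a - b)"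
  shows "h b \<le> h a + grad h a \<bullet> (b - a) + L / 2 * (norm (b - a))\<^sup>2"
proof -
  define k where "k = b - a"
  \<comment> \<open>Up to the constant \<open>h a\<close>, this is \<open>h\<close> minus the
    quadratic model at parameter \<open>t\<close>; its derivative is nonpositive by Cauchy-Schwarz
    and the Lipschitz bound.\<close>
  define \<phi> where "\<phi> t = h (a + t *\<^sub>R k) - t * (grad h a \<bullet> k) - L / 2 * t\<^sup>2 * (norm k)\<^sup>2" for t
  have "\<exists>y. DERIV \<phi> t :> y \<and> y \<le> 0" if t: "0 \<le> t" "t \<le> 1" for t
  proof -
    have "((\<lambda>t. h (a + t *\<^sub>R k)) has_derivative (\<lambda>e. (e *\<^sub>R k) \<bullet> grad h (a + t *\<^sub>R k))) (at t)"
    proof -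
      have "((\<lambda>t. a + t *\<^sub>R k) has_derivative (\<lambda>e. e *\<^sub>R k)) (at t)"
        by (auto intro!: derivative_eq_intros)
      from has_derivative_compose[OF this deriv[of "a + t *\<^sub>R k", unfolded gderiv_def]]
      show ?thesis .
    qed
    then have "DERIV (\<lambda>t. h (a + t *\<^sub>R k)) t :> k \<bullet> grad h (a + t *\<^sub>R k)"
      by (simp add: has_field_derivative_def mult_commute_abs)
    then have D: "DERIV \<phi> t :> k \<bullet> grad h (a + t *\<^sub>R k) - grad h a \<bullet> k - L * t * (norm k)\<^sup>2"
      unfolding \<phi>_def by (auto intro!: derivative_eq_intros)
    have "k \<bullet> (grad h (a + t *\<^sub>R k) - grad h a) \<le> norm k * norm (grad h (a + t *\<^sub>R k) - grad h a)"
      by (rule norm_cauchy_schwarz)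
    also have "\<dots> \<le> norm k * (L * norm (a + t *\<^sub>R k - a))"
      by (intro mult_left_mono lip) auto
    also have "\<dots> = L * t * (norm k)\<^sup>2"
      using t by (simp add: power2_eq_square)
    finally show ?thesis
      using D by (intro exI conjI) (assumption, simp add: inner_diff_right inner_commute)
  qed
  then have "\<phi> 1 \<le> \<phi> 0"
    by (intro DERIV_nonpos_imp_nonincreasing[of 0 1 \<phi>]) simp_all
  then show ?thesis
    by (simp add: \<phi>_def k_def)
qed

section \<open>Spectral bounds\<close>

lemma inner_matrix_vector_transpose:
  fixes A :: "real^'d^'m"
  shows "w \<bullet> (A *v y) = (transpose A *v w) \<bullet> y"
  unfolding transpose_matrix_vector dot_lmul_matrix by (rule refl)

text \<open>With y the image of \<open>w\<close> under the transpose, the square of |y| is the inner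
  product of \<open>w\<close> with Ay, hence at most |w| |A| |y|. Cancelling |y| requires it to be
  nonzero.\<close>

lemma norm_transpose_matrix_vector_le:
  fixes A :: "real^'d^'m"
  shows "norm (transpose A *v w) \<le> onorm ((*v) A) * norm w"
proof (cases "transpose A *v w = 0")
  case False
  have "norm (transpose A *v w) * norm (transpose A *v w) = w \<bullet> (A *v (transpose A *v w))"
    by (simp add: inner_matrix_vector_transpose dot_square_norm power2_eq_square)
  also have "\<dots> \<le> norm w * norm (A *v (transpose A *v w))"
    by (rule norm_cauchy_schwarz)
  also have "\<dots> \<le> norm w * (onorm ((*v) A) * norm (transpose A *v w))"
    by (intro mult_left_mono onorm) auto
  finally show ?thesis
    using False by (simp add: mult_ac)
qed (simp add: onorm_pos_le)

lemma norm_diff_sq: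
  fixes a b :: "'x::real_inner"
  shows "(norm (a - e *\<^sub>R b))\<^sup>2 = (norm a)\<^sup>2 - 2 * e * (a \<bullet> b) + e\<^sup>2 * (norm b)\<^sup>2"
  by (simp add: power2_norm_eq_inner inner_diff_left inner_diff_right inner_commute power2_eq_square[of e])

text \<open>In the expansion of the squared norm, the condition on \<tau> lets the negative cross
  term absorb the square of the Gram term, which leaves only \<tau> squared times |y|
  squared.\<close>

lemma norm_shifted_gram_le:
  fixes A :: "real^'d^'m"
  assumes "0 \<le> \<beta>" and "0 \<le> \<tau>" and "\<beta> * (onorm ((*v) A))\<^sup>2 \<le> 2 * \<tau>"
  shows "norm ((\<tau> *\<^sub>R mat 1 - \<beta> *\<^sub>R (transpose A ** A)) *v y) \<le> \<tau> * norm y"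
proof (rule power2_le_imp_le)
  let ?a = "onorm ((*v) A)"
  have "(norm (transpose A *v (A *v y)))\<^sup>2 \<le> ?a\<^sup>2 * (norm (A *v y))\<^sup>2"
    using power_mono[OF norm_transpose_matrix_vector_le[of A "A *v y"], of 2]
    by (simp add: power_mult_distrib)
  then have "\<beta>\<^sup>2 * (norm (transpose A *v (A *v y)))\<^sup>2 \<le> \<beta> * (\<beta> * ?a\<^sup>2) * (norm (A *v y))\<^sup>2"
    using mult_left_mono[of "(norm (transpose A *v (A *v y)))\<^sup>2" _ "\<beta>\<^sup>2"]
    by (auto simp: power2_eq_square[of \<beta>] mult.assoc)
  also have "\<dots> \<le> \<beta> * (2 * \<tau>) * (norm (A *v y))\<^sup>2"
    using assms by (intro mult_right_mono mult_left_mono) auto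
  finally have *: "\<beta>\<^sup>2 * (norm (transpose A *v (A *v y)))\<^sup>2 \<le> 2 * \<tau> * \<beta> * (norm (A *v y))\<^sup>2"
    by (simp add: mult_ac)
  have "(\<tau> *\<^sub>R mat 1 - \<beta> *\<^sub>R (transpose A ** A)) *v y = \<tau> *\<^sub>R y - \<beta> *\<^sub>R (transpose A *v (A *v y))"
    by (simp add: matrix_vector_mult_diff_rdistrib matrix_vector_mul_assoc
        flip: scaleR_matrix_vector_assoc)
  then have "(norm ((\<tau> *\<^sub>R mat 1 - \<beta> *\<^sub>R (transpose A ** A)) *v y))\<^sup>2
      = \<tau>\<^sup>2 * (norm y)\<^sup>2 - 2 * \<tau> * \<beta> * (norm (A *v y))\<^sup>2
        + \<beta>\<^sup>2 * (norm (transpose A *v (A *v y)))\<^sup>2"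
    using inner_matrix_vector_transpose[of "A *v y" A y] norm_diff_sq[of "\<tau> *\<^sub>R y" \<beta> "transpose A *v (A *v y)"]
    by (simp add: power2_norm_eq_inner[of "A *v y"] power_mult_distrib inner_commute)
  then show "(norm ((\<tau> *\<^sub>R mat 1 - \<beta> *\<^sub>R (transpose A ** A)) *v y))\<^sup>2 \<le> (\<tau> * norm y)\<^sup>2"
    using * by (simp add: power_mult_distrib)
qed (use assms in auto)

text \<open>The witness minimises the Rayleigh quotient on the unit sphere, where compactness gives
  a minimiser. A variation argument shows that it is an eigenvector, and every eigenvalue is a
  Rayleigh quotient, so the minimum is the least one.\<close>

lemma smallest_eigenvalue_gram:
  fixes A :: "real^'d^'m"
  obtains w where "norm w = 1"
    and "smallest_eigenvalue (A ** transpose A) = (norm (transpose A *v w))\<^sup>2"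
    and "\<And>y. smallest_eigenvalue (A ** transpose A) * (norm y)\<^sup>2 \<le> (norm (transpose A *v y))\<^sup>2"
proof -
  define q where "q y = (norm (transpose A *v y))\<^sup>2" for y
  have "compact (sphere (0::real^'m) 1)" "sphere (0::real^'m) 1 \<noteq> {}"
    by auto
  moreover have "continuous_on (sphere 0 1) q"
    unfolding q_def by (intro continuous_intros linear_continuous_on matrix_vector_mul_bounded_linear)
  ultimately obtain w where w: "norm w = 1" and min: "\<And>y. norm y = 1 \<Longrightarrow> q w \<le> q y"
    using continuous_attains_inf[of "sphere 0 1" q] by auto
  define m where "m = q w"
  have bound: "m * (norm y)\<^sup>2 \<le> q y" for y
  proof (cases "y = 0")
    case False
    have "m \<le> q ((1 / norm y) *\<^sub>R y)"
      unfolding m_def using False by (intro min) simp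
    also have "\<dots> = q y / (norm y)\<^sup>2"
      by (simp add: q_def matrix_vector_mult_scaleR power_mult_distrib power_divide)
    finally show ?thesis
      using False by (simp add: field_simps)
  qed (simp add: q_def)
  \<comment> \<open>The residual of the eigenvector equation at \<open>w\<close>, which is also the
    direction of the variation. If it were nonzero, a small step along \<open>- d\<close> would
    violate \<open>bound\<close>.\<close>
  define d where "d = A *v (transpose A *v w) - m *\<^sub>R w"
  have expand: "q (w - e *\<^sub>R d) - m * (norm (w - e *\<^sub>R d))\<^sup>2
      = e * (e * (q d - m * (norm d)\<^sup>2) - 2 * (norm d)\<^sup>2)" for e
  proof -
    have "(transpose A *v w) \<bullet> (transpose A *v d) = (norm d)\<^sup>2 + m * (w \<bullet> d)"
    proof -
      have "(transpose A *v w) \<bullet> (transpose A *v d) = (A *v (transpose A *v w)) \<bullet> d"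
        using inner_matrix_vector_transpose[of d A "transpose A *v w"] by (simp add: inner_commute)
      also have "A *v (transpose A *v w) = d + m *\<^sub>R w"
        by (simp add: d_def)
      finally show ?thesis
        by (simp add: inner_add_left power2_norm_eq_inner)
    qed
    moreover have "q (w - e *\<^sub>R d) = m - 2 * e * ((transpose A *v w) \<bullet> (transpose A *v d)) + e\<^sup>2 * q d"
      unfolding m_def q_def matrix_vector_mult_diff_distrib matrix_vector_mult_scaleR norm_diff_sq
      by simp
    moreover have "(norm (w - e *\<^sub>R d))\<^sup>2 = 1 - 2 * e * (w \<bullet> d) + e\<^sup>2 * (norm d)\<^sup>2"
      unfolding norm_diff_sq using w by simp
    ultimately show ?thesis
      by (simp only: power2_eq_square) (simp add: algebra_simps)
  qed
  have "norm d = 0"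
  proof (rule ccontr)
    assume "norm d \<noteq> 0"
    define Q where "Q = q d - m * (norm d)\<^sup>2"
    have Q: "0 \<le> Q"
      using bound[of d] by (simp add: Q_def)
    \<comment> \<open>Since \<open>Q\<close> is nonnegative, the denominator is positive and
      \<open>e * Q\<close> is at most the square of |d|. The first-order term in
      \<open>expand\<close> therefore dominates and the expression is negative.\<close>
    define e where "e = (norm d)\<^sup>2 / (Q + 1)"
    have e: "e > 0"
      using \<open>norm d \<noteq> 0\<close> Q by (auto simp: e_def intro!: divide_pos_pos add_nonneg_pos)
    have "e * (Q + 1) = (norm d)\<^sup>2"
      using Q by (simp add: e_def)
    then have "e * Q - 2 * (norm d)\<^sup>2 < 0"
      using e \<open>norm d \<noteq> 0\<close> zero_less_power2[of "norm d"] unfolding distrib_left mult_1_right by linarith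
    then have "e * (e * Q - 2 * (norm d)\<^sup>2) < 0"
      using e by (simp add: mult_pos_neg)
    then show False
      using expand[of e] bound[of "w - e *\<^sub>R d"] by (simp add: Q_def)
  qed
  then have "is_eigenvalue (A ** transpose A) m"
    unfolding is_eigenvalue_def d_def using w
    by (intro exI[of _ w]) (auto simp flip: matrix_vector_mul_assoc)
  moreover have "m \<le> l" if "is_eigenvalue (A ** transpose A) l" for l
  proof -
    obtain y where y: "y \<noteq> 0" "A *v (transpose A *v y) = l *\<^sub>R y"
      using \<open>is_eigenvalue _ l\<close> by (auto simp: is_eigenvalue_def simp flip: matrix_vector_mul_assoc)
    have "q y = l * (norm y)\<^sup>2"
      using inner_matrix_vector_transpose[of y A "transpose A *v y"] y
      by (simp add: q_def power2_norm_eq_inner)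
    then show "m \<le> l"
      using bound[of y] y by simp
  qed
  ultimately have "smallest_eigenvalue (A ** transpose A) = m"
    unfolding smallest_eigenvalue_def by (intro Least_equality)
  then show thesis
    using that[of w] w bound by (simp add: m_def q_def)
qed

lemma smallest_eigenvalue_gram_le:
  fixes A :: "real^'d^'m"
  shows "smallest_eigenvalue (A ** transpose A) * (norm y)\<^sup>2 \<le> (norm (transpose A *v y))\<^sup>2"
  using smallest_eigenvalue_gram by metis

text \<open>Surjectivity makes the transpose injective: if \<open>w = A *v y\<close>, then |w|
  squared is the inner product of \<open>transpose A *v w\<close> with \<open>y\<close>, so the
  transpose cannot kill the unit minimiser.\<close>

lemma smallest_eigenvalue_gram_pos:
  fixes A :: "real^'d^'m"
  assumes "surj ((*v) A)"
  shows "0 < smallest_eigenvalue (A ** transpose A)"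
proof -
  obtain w where w: "norm w = 1" "smallest_eigenvalue (A ** transpose A) = (norm (transpose A *v w))\<^sup>2"
    using smallest_eigenvalue_gram by blast
  obtain y where "w = A *v y"
    using assms by blast
  then have "w \<bullet> w = (transpose A *v w) \<bullet> y"
    using inner_matrix_vector_transpose by metis
  then have "transpose A *v w \<noteq> 0"
    using w(1) by (auto simp: norm_eq_1)
  then show ?thesis
    using w(2) by simp
qed

section \<open>Elementary norm inequalities\<close>

lemma norm_add_sq_le: "(norm (a + b))\<^sup>2 \<le> 2 * (norm a)\<^sup>2 + 2 * (norm b)\<^sup>2"
  for a b :: "'x::real_normed_vector"
proof -
  have "(norm (a + b))\<^sup>2 \<le> (norm a + norm b)\<^sup>2"
    by (intro power_mono norm_triangle_ineq) auto
  also have "\<dots> \<le> 2 * (norm a)\<^sup>2 + 2 * (norm b)\<^sup>2"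
    using sum_squares_bound[of "norm a" "norm b"] by (simp add: power2_sum)
  finally show ?thesis .
qed

lemma norm_diff_sq_le: "(norm (a - b))\<^sup>2 \<le> 2 * (norm a)\<^sup>2 + 2 * (norm b)\<^sup>2"
  for a b :: "'x::real_normed_vector"
  using norm_add_sq_le[of a "- b"] by simp

lemma norm_sq_convex_combination_le:
  fixes a b :: "'x::real_normed_vector"
  assumes "0 \<le> \<sigma>" "\<sigma> \<le> 1"
  shows "(norm ((1 - \<sigma>) *\<^sub>R a + \<sigma> *\<^sub>R b))\<^sup>2 \<le> (1 - \<sigma>) * (norm a)\<^sup>2 + \<sigma> * (norm b)\<^sup>2"
proof -
  have "(norm ((1 - \<sigma>) *\<^sub>R a + \<sigma> *\<^sub>R b))\<^sup>2 \<le> ((1 - \<sigma>) * norm a + \<sigma> * norm b)\<^sup>2"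
    using assms norm_triangle_ineq[of "(1 - \<sigma>) *\<^sub>R a" "\<sigma> *\<^sub>R b"] by (intro power_mono) auto
  also have "\<dots> = (1 - \<sigma>) * (norm a)\<^sup>2 + \<sigma> * (norm b)\<^sup>2 - \<sigma> * (1 - \<sigma>) * (norm a - norm b)\<^sup>2"
    by (simp add: power2_eq_square algebra_simps)
  also have "\<dots> \<le> (1 - \<sigma>) * (norm a)\<^sup>2 + \<sigma> * (norm b)\<^sup>2"
    using assms by simp
  finally show ?thesis .
qed

lemma Young_inner: "- (a \<bullet> b) \<le> c / 2 * (norm a)\<^sup>2 + 1 / (2 * c) * (norm b)\<^sup>2" if "0 < c"
  for a b :: "'x::real_inner"
proof -
  \<comment> \<open>Completing the square in b + c a, written as a difference to match
    \<open>norm_diff_sq\<close>.\<close>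
  have "0 \<le> 1 / (2 * c) * (norm (b - (- c) *\<^sub>R a))\<^sup>2"
    using that by simp
  also have "\<dots> = c / 2 * (norm a)\<^sup>2 + 1 / (2 * c) * (norm b)\<^sup>2 + a \<bullet> b"
    using that unfolding norm_diff_sq by (simp add: field_simps power2_eq_square inner_commute)
  finally show ?thesis
    by simp
qed

section \<open>One iteration\<close>

text \<open>Here \<open>z\<close> is the already updated iterate. Replacing Ax - z by Ax' - z in the
  update of x costs \<beta> times the Gram matrix applied to x' - x, which turns \<tau> Id into
  \<open>B\<close>. The dual update identifies the remaining penalty term.\<close>

lemma admm_dual_residual:
  fixes A :: "real^'d^'m"
  assumes B: "B = \<tau> *\<^sub>R mat 1 - \<beta> *\<^sub>R (transpose A ** A)"
    and "\<tau> \<noteq> 0"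
    and x': "x' = x - (1 / \<tau>) *\<^sub>R (\<gamma> + transpose A *v u + \<beta> *\<^sub>R (transpose A *v (A *v x - z)))"
    and u': "u' = u + (\<sigma> * \<beta>) *\<^sub>R (A *v x' - z)"
  shows "transpose A *v (u' - u) + \<sigma> *\<^sub>R (B *v (x' - x)) = - \<sigma> *\<^sub>R (transpose A *v u + \<gamma>)"
proof -
  have "\<tau> *\<^sub>R (x' - x) = - (\<gamma> + transpose A *v u + \<beta> *\<^sub>R (transpose A *v (A *v x - z)))"
    using \<open>\<tau> \<noteq> 0\<close> by (simp add: x')
  then have "B *v (x' - x) + \<beta> *\<^sub>R (transpose A *v (A *v x' - z)) = - (\<gamma> + transpose A *v u)"
    by (simp add: B matrix_vector_mult_diff_rdistrib matrix_vector_mult_diff_distrib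
        scaleR_diff_right algebra_simps flip: scaleR_matrix_vector_assoc matrix_vector_mul_assoc)
  moreover have "transpose A *v (u' - u) = \<sigma> *\<^sub>R (\<beta> *\<^sub>R (transpose A *v (A *v x' - z)))"
    by (simp add: u' matrix_vector_mult_scaleR)
  ultimately have "transpose A *v (u' - u) + \<sigma> *\<^sub>R (B *v (x' - x)) = \<sigma> *\<^sub>R - (\<gamma> + transpose A *v u)"
    by (metis add.commute scaleR_add_right)
  then show ?thesis
    by (simp add: algebra_simps)
qed

text \<open>\<open>\<gamma>0\<close>, \<open>\<gamma>1\<close> are the estimated and
  \<open>d0\<close>, \<open>d1\<close> the true gradients. The old residual contracts by the factor
  1 - \<sigma>; the perturbation separates into a Lipschitz part and two estimation errors.\<close>

lemma admm_dual_residual_decrease: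
  fixes A :: "real^'d^'m" and B :: "real^'d^'d"
  assumes w: "transpose A *v (u1 - u0) + \<sigma> *\<^sub>R (B *v (x1 - x0)) = - \<sigma> *\<^sub>R (transpose A *v u0 + \<gamma>0)"
    and w': "w' = - \<sigma> *\<^sub>R (transpose A *v u1 + \<gamma>1)"
    and \<sigma>: "0 \<le> \<sigma>" "\<sigma> \<le> 1"
    and B: "norm (B *v (x1 - x0)) \<le> \<tau> * norm (x1 - x0)"
    and lip: "norm (d1 - d0) \<le> L * norm (x1 - x0)"
  shows "(norm w')\<^sup>2
    \<le> (1 - \<sigma>) * (norm (transpose A *v (u1 - u0) + \<sigma> *\<^sub>R (B *v (x1 - x0))))\<^sup>2
      + \<sigma> * (2 * (\<sigma> * \<tau> + L)\<^sup>2 * (norm (x1 - x0))\<^sup>2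
        + 4 * (norm (\<gamma>1 - d1))\<^sup>2 + 4 * (norm (\<gamma>0 - d0))\<^sup>2)"
proof -
  define y where "y = \<sigma> *\<^sub>R (B *v (x1 - x0))"
  define W where "W = transpose A *v (u1 - u0) + y"
  define r where "r = y - (\<gamma>1 - \<gamma>0)"
  have "w' = - \<sigma> *\<^sub>R (transpose A *v u0 + \<gamma>0) - \<sigma> *\<^sub>R (transpose A *v (u1 - u0) + (\<gamma>1 - \<gamma>0))"
    by (simp add: w' matrix_vector_mult_diff_distrib algebra_simps)
  \<comment> \<open>The term \<sigma>B(x1 - x0) belongs to both \<open>W\<close> and
    \<open>r\<close>, so it cancels in \<open>W - r\<close>. This exhibits the new residual as a
    convex combination of \<open>W\<close> and \<open>r\<close>.\<close>
  also have "\<dots> = W - \<sigma> *\<^sub>R (W - r)"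
  proof -
    have "W - r = transpose A *v (u1 - u0) + (\<gamma>1 - \<gamma>0)"
      by (simp add: W_def r_def)
    moreover have "W = - \<sigma> *\<^sub>R (transpose A *v u0 + \<gamma>0)"
      using w unfolding W_def y_def .
    ultimately show ?thesis
      by metis
  qed
  finally have "w' = (1 - \<sigma>) *\<^sub>R W + \<sigma> *\<^sub>R r"
    by (simp add: algebra_simps)
  then have convex: "(norm w')\<^sup>2 \<le> (1 - \<sigma>) * (norm W)\<^sup>2 + \<sigma> * (norm r)\<^sup>2"
    using norm_sq_convex_combination_le \<sigma> by blast
  have "norm (y - (d1 - d0)) \<le> norm y + norm (d1 - d0)"
    by (rule norm_triangle_ineq4)
  also have "\<dots> \<le> \<sigma> * (\<tau> * norm (x1 - x0)) + L * norm (x1 - x0)"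
    using B lip \<sigma> by (intro add_mono) (auto simp: y_def mult_left_mono)
  also have "\<dots> = (\<sigma> * \<tau> + L) * norm (x1 - x0)"
    by (simp add: algebra_simps)
  finally have "(norm (y - (d1 - d0)))\<^sup>2 \<le> (\<sigma> * \<tau> + L)\<^sup>2 * (norm (x1 - x0))\<^sup>2"
    unfolding power_mult_distrib[symmetric] by (intro power_mono) auto
  \<comment> \<open>Inserting the true gradients isolates the estimation errors; splitting the
    square twice gives the factors 2 and 4.\<close>
  moreover have "r = (y - (d1 - d0)) - ((\<gamma>1 - d1) - (\<gamma>0 - d0))"
    by (simp add: r_def)
  then have "(norm r)\<^sup>2 \<le> 2 * (norm (y - (d1 - d0)))\<^sup>2
      + 2 * (2 * (norm (\<gamma>1 - d1))\<^sup>2 + 2 * (norm (\<gamma>0 - d0))\<^sup>2)"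
    using norm_diff_sq_le[of "y - (d1 - d0)" "(\<gamma>1 - d1) - (\<gamma>0 - d0)"]
      norm_diff_sq_le[of "\<gamma>1 - d1" "\<gamma>0 - d0"] by simp
  ultimately have "(norm r)\<^sup>2 \<le> 2 * (\<sigma> * \<tau> + L)\<^sup>2 * (norm (x1 - x0))\<^sup>2
        + 4 * (norm (\<gamma>1 - d1))\<^sup>2 + 4 * (norm (\<gamma>0 - d0))\<^sup>2"
    by simp
  then show ?thesis
    using convex \<sigma> mult_left_mono[of "(norm r)\<^sup>2" _ \<sigma>] unfolding W_def y_def by fastforce
qed

text \<open>The transpose applied to \<open>q\<close> is the residual minus \<sigma>By. The
  eigenvalue bound then transfers control of the residual to \<open>q\<close>.\<close>

lemma admm_multiplier_bound:
  fixes A :: "real^'d^'m" and B :: "real^'d^'d"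
  assumes "norm (B *v y) \<le> \<tau> * norm y"
  shows "smallest_eigenvalue (A ** transpose A) * (norm q)\<^sup>2
    \<le> 2 * (norm (transpose A *v q + \<sigma> *\<^sub>R (B *v y)))\<^sup>2 + 2 * \<sigma>\<^sup>2 * \<tau>\<^sup>2 * (norm y)\<^sup>2"
proof -
  have "(norm (B *v y))\<^sup>2 \<le> \<tau>\<^sup>2 * (norm y)\<^sup>2"
    using power_mono[OF assms, of 2] by (simp add: power_mult_distrib)
  then have "\<sigma>\<^sup>2 * (norm (B *v y))\<^sup>2 \<le> \<sigma>\<^sup>2 * (\<tau>\<^sup>2 * (norm y)\<^sup>2)"
    by (intro mult_left_mono) auto
  then show ?thesis
    using smallest_eigenvalue_gram_le[of A q]
      norm_diff_sq_le[of "transpose A *v q + \<sigma> *\<^sub>R (B *v y)" "\<sigma> *\<^sub>R (B *v y)"]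
    by (simp add: power_mult_distrib)
qed

text \<open>The update equates the estimated gradient plus the gradient of the coupling terms with -
  \<tau>(x' - x). The coupling is expanded exactly, \<open>h\<close> by the descent lemma, and the
  estimation error is absorbed by Young's inequality with parameter \<eta>.\<close>

lemma admm_primal_decrease:
  fixes A :: "real^'d^'m" and h :: "real^'d \<Rightarrow> real"
  assumes deriv: "\<And>a. GDERIV h a :> grad h a"
    and lip: "\<And>a b. norm (grad h a - grad h b) \<le> L * norm (a - b)"
    and pos: "0 < \<tau>" "0 < \<beta>" "0 < \<eta>"
    and x': "x' = x - (1 / \<tau>) *\<^sub>R (\<gamma> + transpose A *v u + \<beta> *\<^sub>R (transpose A *v (A *v x - z)))"
  shows "h x' + u \<bullet> (A *v x' - z) + \<beta> / 2 * (norm (A *v x' - z))\<^sup>2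
    + (\<tau> - (L + \<beta> * (onorm ((*v) A))\<^sup>2) / 2 - 1 / (2 * \<eta>)) * (norm (x' - x))\<^sup>2
    \<le> h x + u \<bullet> (A *v x - z) + \<beta> / 2 * (norm (A *v x - z))\<^sup>2
      + \<eta> / 2 * (norm (\<gamma> - grad h x))\<^sup>2"
proof -
  define k where "k = x' - x"
  \<comment> \<open>The gradient in x of the multiplier and penalty terms at the old point.\<close>
  define p where "p = transpose A *v u + \<beta> *\<^sub>R (transpose A *v (A *v x - z))"
  have "\<gamma> + p = - \<tau> *\<^sub>R k"
    using pos by (simp add: k_def p_def x' add.assoc)
  then have "p = - \<tau> *\<^sub>R k - \<gamma>"
    by (metis add_diff_cancel_left')
  then have p: "p \<bullet> k = - \<tau> * (norm k)\<^sup>2 - \<gamma> \<bullet> k"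
    by (simp add: inner_diff_left power2_norm_eq_inner)
  define r where "r = A *v x - z"
  have Ax': "A *v x' - z = r + A *v k"
    by (simp add: k_def r_def matrix_vector_mult_diff_distrib)
  have "u \<bullet> (A *v x' - z) + \<beta> / 2 * (norm (A *v x' - z))\<^sup>2
      = u \<bullet> r + \<beta> / 2 * (norm r)\<^sup>2 + p \<bullet> k + \<beta> / 2 * (norm (A *v k))\<^sup>2"
    unfolding Ax' p_def r_def[symmetric] inner_add_left inner_scaleR_left
      inner_matrix_vector_transpose[symmetric]
    by (simp add: power2_norm_eq_inner inner_add_left inner_add_right inner_commute field_simps)
  moreover have "(norm (A *v k))\<^sup>2 \<le> (onorm ((*v) A))\<^sup>2 * (norm k)\<^sup>2"
    using power_mono[OF onorm[of "(*v) A" k], of 2] by (simp add: power_mult_distrib)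
  then have "\<beta> / 2 * (norm (A *v k))\<^sup>2 \<le> \<beta> / 2 * ((onorm ((*v) A))\<^sup>2 * (norm k)\<^sup>2)"
    using pos by (intro mult_left_mono) auto
  moreover have "h x' \<le> h x + grad h x \<bullet> k + L / 2 * (norm k)\<^sup>2"
    unfolding k_def by (rule descent_lemma[OF deriv lip])
  moreover have "grad h x \<bullet> k - \<gamma> \<bullet> k \<le> \<eta> / 2 * (norm (\<gamma> - grad h x))\<^sup>2 + 1 / (2 * \<eta>) * (norm k)\<^sup>2"
    using Young_inner[of \<eta> "\<gamma> - grad h x" k] pos by (simp add: inner_diff_left)
  ultimately show ?thesis
    unfolding k_def[symmetric] r_def[symmetric] using p by (simp add: algebra_simps add_divide_distrib diff_divide_distrib)
qed

section \<open>Square integrability\<close>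

lemma sq_integrable_bound:
  assumes "X \<in> borel_measurable M" and "integrable M f"
    and "\<And>\<omega>. \<omega> \<in> space M \<Longrightarrow> (norm (X \<omega>))\<^sup>2 \<le> f \<omega>"
  shows "sq_integrable M X"
  unfolding sq_integrable_def using assms
  by (auto intro!: Bochner_Integration.integrable_bound[OF assms(2)] AE_I2 order_trans[OF _ abs_ge_self])

lemma sq_integrable_cong:
  assumes "\<And>\<omega>. \<omega> \<in> space M \<Longrightarrow> X \<omega> = Y \<omega>" and "sq_integrable M Y"
  shows "sq_integrable M X"
  using assms unfolding sq_integrable_def
  by (metis (no_types, lifting) Bochner_Integration.integrable_cong measurable_cong)

lemma sq_integrable_add:
  fixes X Y :: "'w \<Rightarrow> 'x::{real_normed_vector, second_countable_topology}"
  assumes "sq_integrable M X" and "sq_integrable M Y"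
  shows "sq_integrable M (\<lambda>\<omega>. X \<omega> + Y \<omega>)"
proof (rule sq_integrable_bound)
  show "integrable M (\<lambda>\<omega>. 2 * (norm (X \<omega>))\<^sup>2 + 2 * (norm (Y \<omega>))\<^sup>2)"
    using assms by (simp add: sq_integrable_def)
qed (use assms in \<open>auto simp: sq_integrable_def intro: norm_add_sq_le\<close>)

lemma sq_integrable_bounded_linear:
  assumes "bounded_linear f" and "sq_integrable M X"
  shows "sq_integrable M (\<lambda>\<omega>. f (X \<omega>))"
proof (rule sq_integrable_bound)
  show "integrable M (\<lambda>\<omega>. (onorm f)\<^sup>2 * (norm (X \<omega>))\<^sup>2)"
    using assms by (simp add: sq_integrable_def)
  show "(\<lambda>\<omega>. f (X \<omega>)) \<in> borel_measurable M"
    using assms by (intro measurable_compose[of X M borel f] borel_measurable_continuous_onI)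
      (auto simp: sq_integrable_def linear_continuous_on)
  show "(norm (f (X \<omega>)))\<^sup>2 \<le> (onorm f)\<^sup>2 * (norm (X \<omega>))\<^sup>2" for \<omega>
    using power_mono[OF onorm[OF assms(1)], of "X \<omega>" 2] by (simp add: power_mult_distrib)
qed

lemmas sq_integrable_scaleR = sq_integrable_bounded_linear[OF bounded_linear_scaleR_right]
  and sq_integrable_matrix_vector_mult =
    sq_integrable_bounded_linear[OF matrix_vector_mul_bounded_linear]

lemma sq_integrable_diff:
  fixes X Y :: "'w \<Rightarrow> 'x::{real_normed_vector, second_countable_topology}"
  assumes "sq_integrable M X" and "sq_integrable M Y"
  shows "sq_integrable M (\<lambda>\<omega>. X \<omega> - Y \<omega>)"
  using sq_integrable_add[OF assms(1) sq_integrable_scaleR[OF assms(2), of "-1"]] by simp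

lemma (in finite_measure) sq_integrable_const: "sq_integrable M (\<lambda>_. c)"
  by (simp add: sq_integrable_def)

lemma integrable_inner_sq_integrable:
  fixes X Y :: "'w \<Rightarrow> 'x::{real_inner, second_countable_topology}"
  assumes "sq_integrable M X" and "sq_integrable M Y"
  shows "integrable M (\<lambda>\<omega>. X \<omega> \<bullet> Y \<omega>)"
proof (rule Bochner_Integration.integrable_bound)
  show "integrable M (\<lambda>\<omega>. (norm (X \<omega>))\<^sup>2 + (norm (Y \<omega>))\<^sup>2)"
    using assms by (simp add: sq_integrable_def)
  have "\<bar>X \<omega> \<bullet> Y \<omega>\<bar> \<le> (norm (X \<omega>))\<^sup>2 + (norm (Y \<omega>))\<^sup>2" for \<omega>
    using Cauchy_Schwarz_ineq2[of "X \<omega>" "Y \<omega>"] sum_squares_bound[of "norm (X \<omega>)" "norm (Y \<omega>)"]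
      mult_nonneg_nonneg[of "norm (X \<omega>)" "norm (Y \<omega>)"]
    by simp
  then show "AE \<omega> in M. norm (X \<omega> \<bullet> Y \<omega>) \<le> norm ((norm (X \<omega>))\<^sup>2 + (norm (Y \<omega>))\<^sup>2)"
    by (intro AE_I2) simp
qed (use assms in \<open>auto simp: sq_integrable_def\<close>)

text \<open>For functions bounded below by a constant, an integrable upper bound suffices: constants
  are integrable on a finite measure space. This serves \<open>F\<close> and \<open>H\<close> along
  the iterates.\<close>

lemma (in finite_measure) integrable_between:
  fixes f G :: "'a \<Rightarrow> real"
  assumes "f \<in> borel_measurable M" and "integrable M G"
    and "\<And>\<omega>. \<omega> \<in> space M \<Longrightarrow> c \<le> f \<omega>" and "\<And>\<omega>. \<omega> \<in> space M \<Longrightarrow> f \<omega> \<le> G \<omega>"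
  shows "integrable M f"
proof (rule Bochner_Integration.integrable_bound)
  show "integrable M (\<lambda>\<omega>. \<bar>c\<bar> + \<bar>G \<omega>\<bar>)"
    using assms by simp
  show "AE \<omega> in M. norm (f \<omega>) \<le> norm (\<bar>c\<bar> + \<bar>G \<omega>\<bar>)"
    using assms(3,4) by (intro AE_I2) force
qed (fact assms(1))

lemma measurable_matrix_vector_mult [measurable (raw)]:
  fixes A :: "real^'d^'m"
  assumes "X \<in> borel_measurable N"
  shows "(\<lambda>\<omega>. A *v X \<omega>) \<in> borel_measurable N"
  using assms by (intro measurable_compose[of X N borel "(*v) A"] borel_measurable_continuous_onI)
    (auto intro: linear_continuous_on)

text \<open>If \<open>p t\<close> fell below \<open>c\<close> by \<delta>, monotonicity would keep
  \<open>p\<close> at least that far below, so \<open>k * b\<close> would drop by \<delta> at every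
  later step and eventually become negative.\<close>

lemma telescoping_lower_bound:
  fixes p b :: "nat \<Rightarrow> real"
  assumes "decseq p" and "0 \<le> k" and "\<And>t. 0 \<le> b t" and "\<And>t. k * (b (Suc t) - b t) \<le> p t - c"
  shows "c \<le> p t"
proof (rule ccontr)
  assume "\<not> c \<le> p t"
  then have \<delta>: "0 < c - p t" by simp
  have "k * b (t + n) \<le> k * b t - real n * (c - p t)" for n
  proof (induction n)
    case (Suc n)
    have "k * (b (Suc (t + n)) - b (t + n)) \<le> p t - c"
      using assms(4)[of "t + n"] decseqD[OF assms(1), of t "t + n"] by simp
    then show ?case
      using Suc by (simp add: algebra_simps)
  qed simp
  moreover obtain n where "k * b t < real n * (c - p t)"
    using reals_Archimedean3[OF \<delta>] by blast
  ultimately have "k * b (t + n) < 0"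
    by (meson diff_less_0_iff_less le_less_trans)
  then show False
    using assms(2,3) by (simp add: mult_less_0_iff not_less[symmetric])
qed

section \<open>The random iterates\<close>

text \<open>The finite sum enters only through the gradient of \<open>H\<close> and its Lipschitz
  bound.\<close>

locale stochastic_admm_run = prob_space M
  for M :: "'w measure" +
  fixes Fil :: "nat \<Rightarrow> 'w measure"
    and F :: "real^'m \<Rightarrow> ereal" and H :: "real^'d \<Rightarrow> real" and L :: real and A :: "real^'d^'m"
    and \<beta> \<tau> \<sigma> \<eta> C\<^sub>2 V\<^sub>1 V\<^sub>2 V\<^sub>\<Upsilon> \<rho> :: real
    and g :: "nat \<Rightarrow> ('w, real^'d, real^'d) process_map"
    and s :: nat and v :: "nat \<Rightarrow> nat \<Rightarrow> ('w, real^'d, 'v::euclidean_space) process_map"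
    and x :: "nat \<Rightarrow> 'w \<Rightarrow> real^'d" and z u :: "nat \<Rightarrow> 'w \<Rightarrow> real^'m"
  assumes filtration: "filtration (space M) Fil" and subalgebra: "\<And>t. subalgebra M (Fil t)"
    and proper: "proper_fun F" and lsc: "lower_semicont F"
    and F_bounded: "bounded_from_below F" and H_bounded: "bounded_from_below (\<lambda>a. ereal (H a))"
    and surj: "surj ((*v) A)"
    and L_pos: "0 < L"
    and H_deriv: "\<And>a. GDERIV H a :> grad H a"
    and H_lip: "\<And>a b. norm (grad H a - grad H b) \<le> L * norm (a - b)"
    and \<beta>_pos: "0 < \<beta>" and \<tau>_pos: "0 < \<tau>" and \<sigma>_pos: "0 < \<sigma>" and \<sigma>_le_1: "\<sigma> \<le> 1"
    and \<tau>_large: "\<beta> * (onorm ((*v) A))\<^sup>2 \<le> 2 * \<tau>"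
    and \<eta>_pos: "0 < \<eta>" and C2_pos: "0 < C\<^sub>2"
    and admm: "stochastic_admm M Fil F A \<beta> \<tau> \<sigma> g x z u"
    and vr: "variance_reduced M Fil H g s v V\<^sub>1 V\<^sub>2 V\<^sub>\<Upsilon> \<rho> x"
begin

definition "B = \<tau> *\<^sub>R mat 1 - \<beta> *\<^sub>R (transpose A ** A)"
definition "\<mu> = smallest_eigenvalue (A ** transpose A)"
definition "\<kappa> = 1 / (\<sigma> * \<beta> * \<mu>)"
definition "C\<^sub>0 = 4 * (1 - \<sigma>) / (\<sigma>\<^sup>2 * \<beta> * \<mu>)"
definition "C\<^sub>1 = 8 * (\<sigma> * \<tau> + L)\<^sup>2 * \<kappa>"
text \<open>The total weight of the new squared estimation error: 16\<kappa> from the residual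
  estimate, 16\<kappa> from the next stability function, and \<eta>/2 from Young's inequality in the
  primal step.\<close>

definition "K = 32 * \<kappa> + \<eta> / 2"
definition "C\<^sub>3 = K * (V\<^sub>1 + V\<^sub>\<Upsilon> / \<rho>) + C\<^sub>2 + C\<^sub>1"
definition "a = \<tau> - (L + \<beta> * (onorm ((*v) A))\<^sup>2) / 2 - 4 * \<sigma> * \<tau>\<^sup>2 / (\<beta> * \<mu>) - 1 / (2 * \<eta>)"
text \<open>The variance constant is deducted twice: once for its share in \<open>C\<^sub>3\<close>
  within the next stability function, once for the bounds in conditional expectation.\<close>

definition "\<eta>' = a - C\<^sub>1 - 2 * K * (V\<^sub>1 + V\<^sub>\<Upsilon> / \<rho>) - C\<^sub>2"

definition "dx t \<omega> = x (Suc t) \<omega> - x t \<omega>"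
definition "du t \<omega> = u (Suc t) \<omega> - u t \<omega>"
definition "dz t \<omega> = z (Suc t) \<omega> - z t \<omega>"
definition "err t \<omega> = g t x \<omega> - grad H (x t \<omega>)"
definition "w t \<omega> = transpose A *v du t \<omega> + \<sigma> *\<^sub>R (B *v dx t \<omega>)"
text \<open>The augmented Lagrangian as a real number. It is faithful for positive \<open>t\<close>,
  where \<open>F (z t \<omega>)\<close> is finite on the sample space; finiteness at the initial
  point is not assumed.\<close>

definition "lag t \<omega> = real_of_ereal (F (z t \<omega>)) + H (x t \<omega>)
  + u t \<omega> \<bullet> (A *v x t \<omega> - z t \<omega>) + \<beta> / 2 * (norm (A *v x t \<omega> - z t \<omega>))\<^sup>2"

text \<open>Indexed one lower than in the paper, so that all indices are natural numbers.\<close>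

definition "stab t \<omega> = lag (Suc t) \<omega> + C\<^sub>0 * (norm (w t \<omega>))\<^sup>2 + K / \<rho> * Upsilon s v x (Suc t) \<omega>
  + 16 * \<kappa> * (norm (err t \<omega>))\<^sup>2 + C\<^sub>3 * (norm (dx t \<omega>))\<^sup>2"

section \<open>Signs of the constants and pathwise estimates\<close>

lemma \<mu>_pos: "0 < \<mu>"
  unfolding \<mu>_def by (rule smallest_eigenvalue_gram_pos[OF surj])

lemma \<kappa>_pos: "0 < \<kappa>"
  using \<mu>_pos \<sigma>_pos \<beta>_pos by (simp add: \<kappa>_def)

lemma vr_const: "0 \<le> V\<^sub>1" "0 \<le> V\<^sub>\<Upsilon>" "0 < \<rho>"
  using vr by (auto simp: variance_reduced_def)

lemma const_nonneg: "0 \<le> C\<^sub>0" "0 \<le> C\<^sub>1" "0 < K" "0 \<le> C\<^sub>3"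
  using \<mu>_pos \<kappa>_pos \<sigma>_pos \<sigma>_le_1 \<beta>_pos \<eta>_pos C2_pos vr_const
  by (auto simp: C\<^sub>0_def C\<^sub>1_def C\<^sub>3_def K_def intro!: add_nonneg_nonneg mult_nonneg_nonneg)

lemma update:
  assumes "\<omega> \<in> space M"
  shows "x (Suc t) \<omega> = x t \<omega> - (1 / \<tau>) *\<^sub>R
          (g t x \<omega> + transpose A *v u t \<omega>
            + \<beta> *\<^sub>R (transpose A *v (A *v x t \<omega> - z (Suc t) \<omega>)))"
    and "u (Suc t) \<omega> = u t \<omega> + (\<sigma> * \<beta>) *\<^sub>R (A *v x (Suc t) \<omega> - z (Suc t) \<omega>)"
  using admm assms unfolding stochastic_admm_def by blast+

lemma z_minimises:
  assumes "\<omega> \<in> space M"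
  shows "F (z (Suc t) \<omega>) + ereal (u t \<omega> \<bullet> (A *v x t \<omega> - z (Suc t) \<omega>)
      + \<beta> / 2 * (norm (A *v x t \<omega> - z (Suc t) \<omega>))\<^sup>2)
    \<le> F \<zeta> + ereal (u t \<omega> \<bullet> (A *v x t \<omega> - \<zeta>) + \<beta> / 2 * (norm (A *v x t \<omega> - \<zeta>))\<^sup>2)"
  using admm assms unfolding stochastic_admm_def is_arg_min_def by (meson not_le)

text \<open>Comparing the minimiser with a point of finite value rules out +infinity; properness
  rules out -infinity.\<close>

lemma F_z_finite:
  assumes "\<omega> \<in> space M"
  shows "F (z (Suc t) \<omega>) = ereal (real_of_ereal (F (z (Suc t) \<omega>)))"
proof -
  obtain \<zeta> where "F \<zeta> < \<infinity>"
    using proper by (auto simp: proper_fun_def)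
  then have "F (z (Suc t) \<omega>) < \<infinity>"
    using z_minimises[OF assms, of t \<zeta>] by (cases "F \<zeta>"; cases "F (z (Suc t) \<omega>)") auto
  moreover have "- \<infinity> < F (z (Suc t) \<omega>)"
    using proper by (auto simp: proper_fun_def)
  ultimately show ?thesis
    by (cases "F (z (Suc t) \<omega>)") auto
qed

lemma norm_B_le: "norm (B *v y) \<le> \<tau> * norm y"
  unfolding B_def using \<beta>_pos \<tau>_pos \<tau>_large by (intro norm_shifted_gram_le) auto

lemma w_eq:
  assumes "\<omega> \<in> space M"
  shows "w t \<omega> = - \<sigma> *\<^sub>R (transpose A *v u t \<omega> + g t x \<omega>)"
  unfolding w_def dx_def du_def using \<tau>_pos update[OF assms]
  by (intro admm_dual_residual) (auto simp: B_def)

lemma w_decrease: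
  assumes "\<omega> \<in> space M"
  shows "(norm (w (Suc t) \<omega>))\<^sup>2 \<le> (1 - \<sigma>) * (norm (w t \<omega>))\<^sup>2
      + \<sigma> * (2 * (\<sigma> * \<tau> + L)\<^sup>2 * (norm (dx t \<omega>))\<^sup>2
        + 4 * (norm (err (Suc t) \<omega>))\<^sup>2 + 4 * (norm (err t \<omega>))\<^sup>2)"
  using w_eq[OF assms, of t] w_eq[OF assms, of "Suc t"] \<sigma>_pos \<sigma>_le_1 norm_B_le H_lip
  unfolding w_def[of t] dx_def du_def err_def
  by (intro admm_dual_residual_decrease) auto

text \<open>The z-step and the x-step decrease the Lagrangian up to the error, and the dual step
  increases it by |du| squared over \<sigma>\<beta>. A second copy of that increase is put on both
  sides, since the final inequality retains one.\<close>

lemma lag_decrease: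
  assumes \<omega>: "\<omega> \<in> space M"
  shows "lag (Suc (Suc t)) \<omega> + 1 / (\<sigma> * \<beta>) * (norm (du (Suc t) \<omega>))\<^sup>2
      + (\<tau> - (L + \<beta> * (onorm ((*v) A))\<^sup>2) / 2 - 1 / (2 * \<eta>)) * (norm (dx (Suc t) \<omega>))\<^sup>2
    \<le> lag (Suc t) \<omega> + \<eta> / 2 * (norm (err (Suc t) \<omega>))\<^sup>2
      + 2 / (\<sigma> * \<beta>) * (norm (du (Suc t) \<omega>))\<^sup>2"
proof -
  let ?x = "x (Suc t) \<omega>" and ?x' = "x (Suc (Suc t)) \<omega>" and ?z' = "z (Suc (Suc t)) \<omega>"
    and ?u = "u (Suc t) \<omega>"
  define c where "c = \<tau> - (L + \<beta> * (onorm ((*v) A))\<^sup>2) / 2 - 1 / (2 * \<eta>)"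
  define k where "k = 1 / (\<sigma> * \<beta>)"
  have "real_of_ereal (F ?z') + ?u \<bullet> (A *v ?x - ?z') + \<beta> / 2 * (norm (A *v ?x - ?z'))\<^sup>2
    \<le> real_of_ereal (F (z (Suc t) \<omega>)) + ?u \<bullet> (A *v ?x - z (Suc t) \<omega>)
      + \<beta> / 2 * (norm (A *v ?x - z (Suc t) \<omega>))\<^sup>2"
    using z_minimises[OF \<omega>, of "Suc t" "z (Suc t) \<omega>"]
    by (subst (asm) (1 2) F_z_finite[OF \<omega>]) simp
  moreover have "H ?x' + ?u \<bullet> (A *v ?x' - ?z') + \<beta> / 2 * (norm (A *v ?x' - ?z'))\<^sup>2
    + c * (norm (?x' - ?x))\<^sup>2
    \<le> H ?x + ?u \<bullet> (A *v ?x - ?z') + \<beta> / 2 * (norm (A *v ?x - ?z'))\<^sup>2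
      + \<eta> / 2 * (norm (err (Suc t) \<omega>))\<^sup>2"
    unfolding err_def c_def by (rule admm_primal_decrease[OF H_deriv H_lip \<tau>_pos \<beta>_pos \<eta>_pos update(1)[OF \<omega>]])
  moreover have "A *v ?x' - ?z' = k *\<^sub>R du (Suc t) \<omega>"
    using update(2)[OF \<omega>, of "Suc t"] \<sigma>_pos \<beta>_pos by (simp add: du_def k_def)
  then have "du (Suc t) \<omega> \<bullet> (A *v ?x' - ?z') = k * (norm (du (Suc t) \<omega>))\<^sup>2"
    by (simp only: inner_scaleR_right power2_norm_eq_inner)
  then have "u (Suc (Suc t)) \<omega> \<bullet> (A *v ?x' - ?z')
      = ?u \<bullet> (A *v ?x' - ?z') + k * (norm (du (Suc t) \<omega>))\<^sup>2"
    by (simp only: du_def inner_diff_left)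
  moreover have "2 / (\<sigma> * \<beta>) = 2 * k"
    by (simp add: k_def)
  ultimately show ?thesis
    unfolding lag_def dx_def c_def[symmetric] k_def[symmetric] by simp
qed

text \<open>The variance terms are kept explicit because their bounds hold only in conditional
  expectation. Everything else is settled for each sample point.\<close>

lemma stab_step_pathwise:
  assumes \<omega>: "\<omega> \<in> space M"
  shows "stab (Suc t) \<omega> + \<eta>' * (norm (dx (Suc t) \<omega>))\<^sup>2 + C\<^sub>2 * (norm (dx t \<omega>))\<^sup>2
      + 1 / (\<sigma> * \<beta>) * (norm (du (Suc t) \<omega>))\<^sup>2
    \<le> stab t \<omega> - K / \<rho> * Upsilon s v x (Suc t) \<omega>
      + K * (norm (err (Suc t) \<omega>))\<^sup>2
      + K / \<rho> * Upsilon s v x (Suc (Suc t)) \<omega>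
      - K * (V\<^sub>1 + V\<^sub>\<Upsilon> / \<rho>) * ((norm (dx (Suc t) \<omega>))\<^sup>2 + (norm (dx t \<omega>))\<^sup>2)"
proof -
  let ?W = "(norm (w (Suc t) \<omega>))\<^sup>2" and ?X = "(norm (dx (Suc t) \<omega>))\<^sup>2"
  have "2 / (\<sigma> * \<beta>) * (norm (du (Suc t) \<omega>))\<^sup>2 = 2 * \<kappa> * (\<mu> * (norm (du (Suc t) \<omega>))\<^sup>2)"
    using \<mu>_pos by (simp add: \<kappa>_def)
  also have "\<dots> \<le> 2 * \<kappa> * (2 * ?W + 2 * \<sigma>\<^sup>2 * \<tau>\<^sup>2 * ?X)"
    unfolding \<mu>_def w_def using \<kappa>_pos
    by (intro mult_left_mono admm_multiplier_bound norm_B_le) auto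
  also have "\<dots> = 4 * \<kappa> * ?W + 4 * \<sigma> * \<tau>\<^sup>2 / (\<beta> * \<mu>) * ?X"
    using \<mu>_pos \<beta>_pos \<sigma>_pos by (simp add: \<kappa>_def field_simps power2_eq_square)
  finally have du: "2 / (\<sigma> * \<beta>) * (norm (du (Suc t) \<omega>))\<^sup>2
      \<le> 4 * \<kappa> * ?W + 4 * \<sigma> * \<tau>\<^sup>2 / (\<beta> * \<mu>) * ?X" .
  \<comment> \<open>These identities explain \<open>C\<^sub>0\<close>: its sum with the weight
    4\<kappa> from the dual step, contracted by 1 - \<sigma>, returns to
    \<open>C\<^sub>0\<close>.\<close>
  have C0: "C\<^sub>0 + 4 * \<kappa> = 4 * \<kappa> / \<sigma>" "(4 * \<kappa> / \<sigma>) * (1 - \<sigma>) = C\<^sub>0"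
    using \<mu>_pos \<beta>_pos \<sigma>_pos by (simp_all add: \<kappa>_def C\<^sub>0_def field_simps power2_eq_square)
  have "(C\<^sub>0 + 4 * \<kappa>) * ?W \<le> (4 * \<kappa> / \<sigma>) * ((1 - \<sigma>) * (norm (w t \<omega>))\<^sup>2
      + \<sigma> * (2 * (\<sigma> * \<tau> + L)\<^sup>2 * (norm (dx t \<omega>))\<^sup>2
        + 4 * (norm (err (Suc t) \<omega>))\<^sup>2 + 4 * (norm (err t \<omega>))\<^sup>2))"
    unfolding C0(1) using \<kappa>_pos \<sigma>_pos by (intro mult_left_mono w_decrease[OF \<omega>]) auto
  also have "\<dots> = (4 * \<kappa> / \<sigma> * (1 - \<sigma>)) * (norm (w t \<omega>))\<^sup>2 + C\<^sub>1 * (norm (dx t \<omega>))\<^sup>2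
      + 16 * \<kappa> * (norm (err (Suc t) \<omega>))\<^sup>2 + 16 * \<kappa> * (norm (err t \<omega>))\<^sup>2"
    unfolding C\<^sub>1_def distrib_left using \<sigma>_pos by simp
  finally have W: "C\<^sub>0 * ?W + 4 * \<kappa> * ?W \<le> C\<^sub>0 * (norm (w t \<omega>))\<^sup>2 + C\<^sub>1 * (norm (dx t \<omega>))\<^sup>2
      + 16 * \<kappa> * (norm (err (Suc t) \<omega>))\<^sup>2 + 16 * \<kappa> * (norm (err t \<omega>))\<^sup>2"
    unfolding C0(2) by (simp only: distrib_right)
  define V where "V = K * (V\<^sub>1 + V\<^sub>\<Upsilon> / \<rho>)"
  define b where "b = 4 * \<sigma> * \<tau>\<^sup>2 / (\<beta> * \<mu>)"
  define c where "c = \<tau> - (L + \<beta> * (onorm ((*v) A))\<^sup>2) / 2 - 1 / (2 * \<eta>)"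
  have \<eta>': "\<eta>' = c - b - C\<^sub>1 - 2 * V - C\<^sub>2" and C3: "C\<^sub>3 = V + C\<^sub>2 + C\<^sub>1"
    by (simp_all add: \<eta>'_def a_def b_def c_def V_def C\<^sub>3_def)
  \<comment> \<open>On the new increment \<open>C\<^sub>1\<close>, \<open>C\<^sub>2\<close> and one
    \<open>V\<close> cancel. On the old one, \<open>C\<^sub>3\<close> pays for the residual
    estimate, the retained \<open>C\<^sub>2\<close> term and the variance bounds.\<close>
  have "\<eta>' * ?X + C\<^sub>3 * ?X = c * ?X - b * ?X - V * ?X"
    and "C\<^sub>3 * (norm (dx t \<omega>))\<^sup>2
      = V * (norm (dx t \<omega>))\<^sup>2 + C\<^sub>2 * (norm (dx t \<omega>))\<^sup>2 + C\<^sub>1 * (norm (dx t \<omega>))\<^sup>2"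
    and "V * (?X + (norm (dx t \<omega>))\<^sup>2) = V * ?X + V * (norm (dx t \<omega>))\<^sup>2"
    unfolding \<eta>' C3 by (simp_all add: algebra_simps)
  moreover have "K * (norm (err (Suc t) \<omega>))\<^sup>2
      = 32 * \<kappa> * (norm (err (Suc t) \<omega>))\<^sup>2 + \<eta> / 2 * (norm (err (Suc t) \<omega>))\<^sup>2"
    by (simp add: K_def distrib_right)
  ultimately show ?thesis
    using lag_decrease[OF \<omega>, of t] du W
    unfolding stab_def V_def[symmetric] b_def[symmetric] c_def[symmetric]
    by linarith
qed

section \<open>Measurability and integrability\<close>

lemma measurable_Fil_mono:
  assumes "i \<le> j" and "X \<in> borel_measurable (Fil i)"
  shows "X \<in> borel_measurable (Fil j)"
proof -
  have "subalgebra (Fil j) (Fil i)"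
    using filtration assms(1) unfolding subalgebra_def filtration_def by auto
  then show ?thesis
    using assms(2) measurable_from_subalg by blast
qed

lemma measurable_Fil_M: "X \<in> borel_measurable (Fil t) \<Longrightarrow> X \<in> borel_measurable M"
  using measurable_from_subalg[OF subalgebra] .

lemma adapted_process: "adapted Fil x" "adapted Fil z" "adapted Fil u"
  using admm by (auto simp: stochastic_admm_def)

lemma adapted_measurable_Fil:
  assumes "adapted Fil X" and "i \<le> j"
  shows "X i \<in> borel_measurable (Fil j)"
  using assms measurable_Fil_mono by (auto simp: adapted_def)

lemma g_measurable_Fil: "g t x \<in> borel_measurable (Fil (Suc t))"
  using vr adapted_process(1) by (auto simp: variance_reduced_def gradient_estimator_def)

lemma v_measurable_Fil: "i \<in> {1..s} \<Longrightarrow> v (Suc t) i x \<in> borel_measurable (Fil (Suc t))"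
  using vr adapted_process(1) by (auto simp: variance_reduced_def)

lemma F_measurable [measurable]: "F \<in> borel_measurable borel"
  by (rule lower_semicont_borel_measurable[OF lsc])

lemma H_measurable [measurable]: "H \<in> borel_measurable borel"
proof (intro borel_measurable_continuous_onI continuous_at_imp_continuous_on ballI)
  show "isCont H a" for a
    using H_deriv[of a] unfolding gderiv_def by (rule has_derivative_continuous)
qed

lemma grad_H_measurable [measurable]: "grad H \<in> borel_measurable borel"
proof (intro borel_measurable_continuous_onI lipschitz_on_continuous_on[of L])
  show "L-lipschitz_on UNIV (grad H)"
    using H_lip L_pos by (auto simp: lipschitz_on_def dist_norm)
qed

lemma Upsilon_measurable_Fil: "Upsilon s v x (Suc t) \<in> borel_measurable (Fil (Suc t))"
  unfolding Upsilon_def[abs_def] using v_measurable_Fil by (intro borel_measurable_sum) measurable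

lemma stab_measurable_Fil: "stab t \<in> borel_measurable (Fil (Suc t))"
proof -
  note [measurable] = g_measurable_Fil[of t] Upsilon_measurable_Fil[of t]
    adapted_measurable_Fil[OF adapted_process(1), of t "Suc t"]
    adapted_measurable_Fil[OF adapted_process(1), of "Suc t" "Suc t"]
    adapted_measurable_Fil[OF adapted_process(2), of "Suc t" "Suc t"]
    adapted_measurable_Fil[OF adapted_process(3), of t "Suc t"]
    adapted_measurable_Fil[OF adapted_process(3), of "Suc t" "Suc t"]
  have "lag (Suc t) \<in> borel_measurable (Fil (Suc t))"
    unfolding lag_def[abs_def] by measurable
  moreover have "dx t \<in> borel_measurable (Fil (Suc t))"
    unfolding dx_def[abs_def] by measurable
  moreover have "w t \<in> borel_measurable (Fil (Suc t))"
    unfolding w_def[abs_def] dx_def du_def by measurable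
  moreover have "err t \<in> borel_measurable (Fil (Suc t))"
    unfolding err_def[abs_def] by measurable
  ultimately show ?thesis
    unfolding stab_def[abs_def] by measurable
qed

lemma g_sq_integrable: "sq_integrable M (g t x)"
  using admm by (auto simp: stochastic_admm_def)

text \<open>Minimality is tested against a fixed point where \<open>F\<close> is finite. The lower
  bound of \<open>F\<close> first makes the penalty term integrable; the same inequality then bounds
  \<open>F\<close> at the minimiser from above.\<close>

lemma z_sq_integrable_F_integrable:
  assumes x: "sq_integrable M (x t)" and u: "sq_integrable M (u t)"
  shows "sq_integrable M (z (Suc t))"
    and "integrable M (\<lambda>\<omega>. real_of_ereal (F (z (Suc t) \<omega>)))"
proof -
  obtain \<zeta> r where r: "F \<zeta> = ereal r"
  proof -
    obtain \<zeta> where "F \<zeta> < \<infinity>" "- \<infinity> < F \<zeta>"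
      using proper by (auto simp: proper_fun_def)
    then show thesis
      using that by (cases "F \<zeta>") auto
  qed
  obtain c where c: "ereal c \<le> F y" for y
    using F_bounded by (auto simp: bounded_from_below_def)
  define f where "f \<omega> = real_of_ereal (F (z (Suc t) \<omega>))" for \<omega>
  define d where "d \<omega> = A *v x t \<omega> - z (Suc t) \<omega>" for \<omega>
  define y where "y \<omega> = A *v x t \<omega> - \<zeta>" for \<omega>
  have [measurable]: "x t \<in> borel_measurable M" "u t \<in> borel_measurable M" "z (Suc t) \<in> borel_measurable M"
    using adapted_process by (auto intro: measurable_Fil_M adapted_measurable_Fil[OF _ order_refl])
  have Ax: "sq_integrable M (\<lambda>\<omega>. A *v x t \<omega>)"
    by (rule sq_integrable_matrix_vector_mult[OF x])
  then have y: "sq_integrable M y"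
    unfolding y_def by (intro sq_integrable_diff sq_integrable_const)
  have f_ge: "c \<le> f \<omega>" if "\<omega> \<in> space M" for \<omega>
    using c[of "z (Suc t) \<omega>"] by (subst (asm) F_z_finite[OF that]) (simp add: f_def)
  have min: "f \<omega> + u t \<omega> \<bullet> d \<omega> + \<beta> / 2 * (norm (d \<omega>))\<^sup>2
      \<le> r + u t \<omega> \<bullet> y \<omega> + \<beta> / 2 * (norm (y \<omega>))\<^sup>2" if "\<omega> \<in> space M" for \<omega>
    using z_minimises[OF that, of t \<zeta>]
    by (subst (asm) F_z_finite[OF that]) (simp add: r f_def d_def y_def)
  have d: "sq_integrable M d"
  proof (rule sq_integrable_bound)
    let ?q = "\<lambda>\<omega>. 4 / \<beta> * (r - c + u t \<omega> \<bullet> y \<omega> + \<beta> / 2 * (norm (y \<omega>))\<^sup>2 + 1 / \<beta> * (norm (u t \<omega>))\<^sup>2)"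
    show "integrable M ?q"
      using integrable_inner_sq_integrable[OF u y] u y by (auto simp: sq_integrable_def)
    show "(norm (d \<omega>))\<^sup>2 \<le> ?q \<omega>" if "\<omega> \<in> space M" for \<omega>
    proof -
      \<comment> \<open>Young's parameter \<beta>/2 uses up half of the penalty coefficient
        \<beta>/2, so \<beta>/4 survives.\<close>
      have "- (d \<omega> \<bullet> u t \<omega>) \<le> \<beta> / 4 * (norm (d \<omega>))\<^sup>2 + 1 / \<beta> * (norm (u t \<omega>))\<^sup>2"
        using Young_inner[of "\<beta> / 2" "d \<omega>" "u t \<omega>"] \<beta>_pos by simp
      then have "\<beta> / 4 * (norm (d \<omega>))\<^sup>2
          \<le> r - c + u t \<omega> \<bullet> y \<omega> + \<beta> / 2 * (norm (y \<omega>))\<^sup>2 + 1 / \<beta> * (norm (u t \<omega>))\<^sup>2"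
        using min[OF that] f_ge[OF that] inner_commute[of "d \<omega>" "u t \<omega>"] by linarith
      then have "4 / \<beta> * (\<beta> / 4 * (norm (d \<omega>))\<^sup>2) \<le> ?q \<omega>"
        using \<beta>_pos by (intro mult_left_mono) auto
      then show ?thesis
        using \<beta>_pos by simp
    qed
  qed (unfold d_def[abs_def], measurable)
  then have "sq_integrable M (\<lambda>\<omega>. A *v x t \<omega> - d \<omega>)"
    by (intro sq_integrable_diff Ax)
  then show "sq_integrable M (z (Suc t))"
    by (simp add: d_def)
  have "integrable M f"
  proof (rule integrable_between)
    let ?G = "\<lambda>\<omega>. r + u t \<omega> \<bullet> y \<omega> + \<beta> / 2 * (norm (y \<omega>))\<^sup>2 - u t \<omega> \<bullet> d \<omega> - \<beta> / 2 * (norm (d \<omega>))\<^sup>2"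
    show "integrable M ?G"
      using integrable_inner_sq_integrable[OF u y] integrable_inner_sq_integrable[OF u d] y d
      by (auto simp: sq_integrable_def)
    show "f \<omega> \<le> ?G \<omega>" if "\<omega> \<in> space M" for \<omega>
      using min[OF that] by simp
    show "f \<in> borel_measurable M"
      unfolding f_def by measurable
  qed (rule f_ge)
  then show "integrable M (\<lambda>\<omega>. real_of_ereal (F (z (Suc t) \<omega>)))"
    unfolding f_def[abs_def] .
qed

text \<open>The induction is joint because the next z depends on both processes; integrability then
  passes from z to x and from these to u.\<close>

lemma xu_sq_integrable: "sq_integrable M (x t) \<and> sq_integrable M (u t)"
proof (induction t)
  case 0
  then show ?case
    using admm by (simp add: stochastic_admm_def)
next
  case (Suc t)
  then have z: "sq_integrable M (z (Suc t))"
    using z_sq_integrable_F_integrable by blast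
  have x: "sq_integrable M (x (Suc t))"
    using Suc z g_sq_integrable
    by (intro sq_integrable_cong[OF update(1)] sq_integrable_diff sq_integrable_add
        sq_integrable_scaleR sq_integrable_matrix_vector_mult) auto
  moreover have "sq_integrable M (u (Suc t))"
    using Suc z x
    by (intro sq_integrable_cong[OF update(2)] sq_integrable_diff sq_integrable_add
        sq_integrable_scaleR sq_integrable_matrix_vector_mult) auto
  ultimately show ?case ..
qed

lemmas x_sq_integrable = xu_sq_integrable[THEN conjunct1]
  and u_sq_integrable = xu_sq_integrable[THEN conjunct2]

lemma z_sq_integrable: "sq_integrable M (z t)"
proof (cases t)
  case 0
  then show ?thesis
    using admm by (simp add: stochastic_admm_def)
qed (use z_sq_integrable_F_integrable(1)[OF x_sq_integrable u_sq_integrable] in auto)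

lemma increments_sq_integrable:
  "sq_integrable M (dx t)" "sq_integrable M (du t)" "sq_integrable M (dz t)"
  unfolding dx_def[abs_def] du_def[abs_def] dz_def[abs_def]
  by (intro sq_integrable_diff x_sq_integrable u_sq_integrable z_sq_integrable)+

lemma w_sq_integrable: "sq_integrable M (w t)"
  unfolding w_def[abs_def]
  by (intro sq_integrable_add sq_integrable_scaleR sq_integrable_matrix_vector_mult
      increments_sq_integrable)

text \<open>By the Lipschitz bound, the gradient differs from its value at 0 by at most
  \<open>L\<close> times the norm of the iterate.\<close>

lemma err_sq_integrable: "sq_integrable M (err t)"
proof -
  have [measurable]: "x t \<in> borel_measurable M"
    using x_sq_integrable by (auto simp: sq_integrable_def)
  have "sq_integrable M (\<lambda>\<omega>. grad H (x t \<omega>) - grad H 0)"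
  proof (rule sq_integrable_bound)
    show "integrable M (\<lambda>\<omega>. L\<^sup>2 * (norm (x t \<omega>))\<^sup>2)"
      using x_sq_integrable by (simp add: sq_integrable_def)
    show "(norm (grad H (x t \<omega>) - grad H 0))\<^sup>2 \<le> L\<^sup>2 * (norm (x t \<omega>))\<^sup>2" for \<omega>
      using power_mono[OF H_lip[of "x t \<omega>" 0], of 2] by (simp add: power_mult_distrib)
  qed measurable
  from sq_integrable_diff[OF sq_integrable_diff[OF g_sq_integrable this] sq_integrable_const, of t "grad H 0"]
  show ?thesis
    by (simp add: err_def[abs_def])
qed

lemma Upsilon_integrable: "integrable M (Upsilon s v x (Suc t))"
  using vr unfolding Upsilon_def[abs_def] variance_reduced_def sq_integrable_def by auto

text \<open>\<open>H\<close> lies between a constant and the quadratic given by the descent lemma at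
  0.\<close>

lemma H_integrable: "integrable M (\<lambda>\<omega>. H (x t \<omega>))"
proof -
  obtain c where c: "ereal c \<le> ereal (H y)" for y
    using H_bounded unfolding bounded_from_below_def by blast
  have [measurable]: "x t \<in> borel_measurable M"
    using x_sq_integrable by (auto simp: sq_integrable_def)
  show ?thesis
  proof (rule integrable_between)
    show "integrable M (\<lambda>\<omega>. H 0 + grad H 0 \<bullet> x t \<omega> + L / 2 * (norm (x t \<omega>))\<^sup>2)"
      using integrable_inner_sq_integrable[OF sq_integrable_const x_sq_integrable] x_sq_integrable
      by (auto simp: sq_integrable_def)
    show "H (x t \<omega>) \<le> H 0 + grad H 0 \<bullet> x t \<omega> + L / 2 * (norm (x t \<omega>))\<^sup>2" for \<omega>
      using descent_lemma[OF H_deriv H_lip, of "x t \<omega>" 0] by simp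
  qed (use c in simp_all)
qed

lemma stab_integrable: "integrable M (stab t)"
proof -
  have "sq_integrable M (\<lambda>\<omega>. A *v x (Suc t) \<omega> - z (Suc t) \<omega>)"
    by (intro sq_integrable_diff sq_integrable_matrix_vector_mult x_sq_integrable z_sq_integrable)
  then show ?thesis
    using integrable_inner_sq_integrable[OF u_sq_integrable] H_integrable Upsilon_integrable
      z_sq_integrable_F_integrable(2)[OF x_sq_integrable u_sq_integrable]
      w_sq_integrable err_sq_integrable increments_sq_integrable
    unfolding stab_def[abs_def] lag_def sq_integrable_def by auto
qed

section \<open>Descent in conditional expectation\<close>

sublocale finite_measure_subalgebra M "Fil t" for t
  by unfold_locales (rule subalgebra)

definition "next_stab t \<omega> = stab (Suc t) \<omega> + \<eta>' * (norm (dx (Suc t) \<omega>))\<^sup>2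
  + C\<^sub>2 * (norm (dx t \<omega>))\<^sup>2 + 1 / (\<sigma> * \<beta>) * (norm (du (Suc t) \<omega>))\<^sup>2"

lemma next_stab_integrable: "integrable M (next_stab t)"
  unfolding next_stab_def[abs_def] using stab_integrable increments_sq_integrable by (auto simp: sq_integrable_def)

lemma mse_bound:
  "AE \<omega> in M. real_cond_exp M (Fil (Suc t)) (\<lambda>\<omega>. (norm (err (Suc t) \<omega>))\<^sup>2) \<omega>
    \<le> Upsilon s v x (Suc t) \<omega>
      + V\<^sub>1 * (real_cond_exp M (Fil (Suc t)) (\<lambda>\<omega>. (norm (dx (Suc t) \<omega>))\<^sup>2) \<omega> + (norm (dx t \<omega>))\<^sup>2)"
proof -
  have "\<forall>t\<ge>1. AE \<omega> in M.
        real_cond_exp M (Fil t) (\<lambda>\<omega>. (norm (g t x \<omega> - grad H (x t \<omega>)))\<^sup>2) \<omega>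
        \<le> Upsilon s v x t \<omega>
          + V\<^sub>1 * (real_cond_exp M (Fil t) (\<lambda>\<omega>. (norm (x (t + 1) \<omega> - x t \<omega>))\<^sup>2) \<omega>
                  + (norm (x t \<omega> - x (t - 1) \<omega>))\<^sup>2)"
    using vr unfolding variance_reduced_def by blast
  from this[rule_format, of "Suc t"] show ?thesis
    by (simp add: err_def dx_def)
qed

lemma geometric_decay:
  "AE \<omega> in M. real_cond_exp M (Fil (Suc t)) (Upsilon s v x (Suc (Suc t))) \<omega>
    \<le> (1 - \<rho>) * Upsilon s v x (Suc t) \<omega>
      + V\<^sub>\<Upsilon> * (real_cond_exp M (Fil (Suc t)) (\<lambda>\<omega>. (norm (dx (Suc t) \<omega>))\<^sup>2) \<omega> + (norm (dx t \<omega>))\<^sup>2)"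
proof -
  have "\<forall>t\<ge>1. AE \<omega> in M.
        real_cond_exp M (Fil t) (Upsilon s v x (t + 1)) \<omega>
        \<le> (1 - \<rho>) * Upsilon s v x t \<omega>
          + V\<^sub>\<Upsilon> * (real_cond_exp M (Fil t) (\<lambda>\<omega>. (norm (x (t + 1) \<omega> - x t \<omega>))\<^sup>2) \<omega>
                  + (norm (x t \<omega> - x (t - 1) \<omega>))\<^sup>2)"
    using vr unfolding variance_reduced_def by blast
  from this[rule_format, of "Suc t"] show ?thesis
    by (simp add: dx_def)
qed

lemma stab_step: "AE \<omega> in M. real_cond_exp M (Fil (Suc t)) (next_stab t) \<omega> \<le> stab t \<omega>"
proof -
  let ?E = "real_cond_exp M (Fil (Suc t))" and ?D = "next_stab t"
  let ?V = "K * (V\<^sub>1 + V\<^sub>\<Upsilon> / \<rho>)"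
  \<comment> \<open>\<open>R\<close> collects the part known at time \<open>Suc t\<close>, which
    conditioning leaves unchanged. Only \<open>e\<close>, \<open>Y\<close> and \<open>X\<close>
    remain to be estimated.\<close>
  define R where
    "R \<omega> = stab t \<omega> - K / \<rho> * Upsilon s v x (Suc t) \<omega> - ?V * (norm (dx t \<omega>))\<^sup>2" for \<omega>
  define e where "e \<omega> = (norm (err (Suc t) \<omega>))\<^sup>2" for \<omega>
  define Y where "Y = Upsilon s v x (Suc (Suc t))"
  define X where "X \<omega> = (norm (dx (Suc t) \<omega>))\<^sup>2" for \<omega>
  have R: "integrable M R" and e: "integrable M e" and Y: "integrable M Y" and X: "integrable M X"
    using stab_integrable Upsilon_integrable increments_sq_integrable err_sq_integrable
    by (auto simp: R_def[abs_def] e_def[abs_def] Y_def X_def[abs_def] sq_integrable_def)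
  have [measurable]: "x t \<in> borel_measurable (Fil (Suc t))" "x (Suc t) \<in> borel_measurable (Fil (Suc t))"
    using adapted_measurable_Fil[OF adapted_process(1)] by auto
  have "R \<in> borel_measurable (Fil (Suc t))"
    unfolding R_def[abs_def] dx_def using stab_measurable_Fil Upsilon_measurable_Fil by measurable
  then have ER: "AE \<omega> in M. ?E R \<omega> = R \<omega>"
    using R by (intro real_cond_exp_F_meas)
  have "AE \<omega> in M. ?E ?D \<omega> \<le> ?E (\<lambda>\<omega>. (R \<omega> + K * e \<omega>) + (K / \<rho> * Y \<omega> + (- ?V) * X \<omega>)) \<omega>"
  proof (rule real_cond_exp_mono)
    show "AE \<omega> in M. ?D \<omega> \<le> (R \<omega> + K * e \<omega>) + (K / \<rho> * Y \<omega> + (- ?V) * X \<omega>)"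
    proof (rule AE_I2)
      fix \<omega> assume "\<omega> \<in> space M"
      from stab_step_pathwise[OF this, of t]
      show "?D \<omega> \<le> (R \<omega> + K * e \<omega>) + (K / \<rho> * Y \<omega> + (- ?V) * X \<omega>)"
        unfolding next_stab_def R_def e_def Y_def X_def distrib_left by linarith
    qed
  qed (use next_stab_integrable R e Y X in auto)
  moreover have "AE \<omega> in M. ?E (\<lambda>\<omega>. (R \<omega> + K * e \<omega>) + (K / \<rho> * Y \<omega> + (- ?V) * X \<omega>)) \<omega>
      = ?E (\<lambda>\<omega>. R \<omega> + K * e \<omega>) \<omega> + ?E (\<lambda>\<omega>. K / \<rho> * Y \<omega> + (- ?V) * X \<omega>) \<omega>"
    using R e Y X by (intro real_cond_exp_add) auto
  moreover have "AE \<omega> in M. ?E (\<lambda>\<omega>. R \<omega> + K * e \<omega>) \<omega> = ?E R \<omega> + ?E (\<lambda>\<omega>. K * e \<omega>) \<omega>"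
    using R e by (intro real_cond_exp_add) auto
  moreover have "AE \<omega> in M. ?E (\<lambda>\<omega>. K / \<rho> * Y \<omega> + (- ?V) * X \<omega>) \<omega>
      = ?E (\<lambda>\<omega>. K / \<rho> * Y \<omega>) \<omega> + ?E (\<lambda>\<omega>. (- ?V) * X \<omega>) \<omega>"
    using Y X by (intro real_cond_exp_add) auto
  moreover note real_cond_exp_cmult[OF e, of "Suc t" K] real_cond_exp_cmult[OF Y, of "Suc t" "K / \<rho>"]
    real_cond_exp_cmult[OF X, of "Suc t" "- ?V"] ER
    mse_bound[of t, folded e_def X_def] geometric_decay[of t, folded Y_def X_def]
  ultimately show ?thesis
  proof eventually_elim
    case (elim \<omega>)
    let ?U = "Upsilon s v x (Suc t) \<omega>" and ?d = "(norm (dx t \<omega>))\<^sup>2"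
    have "K * ?E e \<omega> \<le> K * (?U + V\<^sub>1 * (?E X \<omega> + ?d))"
      using elim const_nonneg by (intro mult_left_mono) auto
    moreover have "K / \<rho> * ?E Y \<omega> \<le> K / \<rho> * ((1 - \<rho>) * ?U + V\<^sub>\<Upsilon> * (?E X \<omega> + ?d))"
      using elim const_nonneg vr_const by (intro mult_left_mono) auto
    \<comment> \<open>This is the reason for the weight \<open>K / \<rho>\<close>: the error bound
      adds \<open>K * ?U\<close>, the decay removes the same amount, and the total cancels against
      \<open>R\<close> and the term in \<open>X\<close>.\<close>
    moreover have "K * (?U + V\<^sub>1 * (?E X \<omega> + ?d)) + K / \<rho> * ((1 - \<rho>) * ?U + V\<^sub>\<Upsilon> * (?E X \<omega> + ?d))
        = K / \<rho> * ?U + ?V * (?E X \<omega> + ?d)"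
      using vr_const by (simp add: field_simps)
    ultimately show ?case
      using elim by (simp add: R_def algebra_simps)
  qed
qed

section \<open>Summability\<close>

text \<open>Integrating the conditional inequality removes the conditioning; the nonnegative
  \<open>C\<^sub>2\<close> term is dropped.\<close>

lemma stab_expectation_step:
  "expectation (stab (Suc t)) + \<eta>' * expectation (\<lambda>\<omega>. (norm (dx (Suc t) \<omega>))\<^sup>2)
      + 1 / (\<sigma> * \<beta>) * expectation (\<lambda>\<omega>. (norm (du (Suc t) \<omega>))\<^sup>2)
    \<le> expectation (stab t)"
proof -
  have "expectation (next_stab t) = expectation (real_cond_exp M (Fil (Suc t)) (next_stab t))"
    using real_cond_exp_int(2)[OF next_stab_integrable] by metis
  also have "\<dots> \<le> expectation (stab t)"
    using real_cond_exp_int(1)[OF next_stab_integrable] stab_integrable stab_step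
    by (intro integral_mono_AE) auto
  finally have "expectation (next_stab t) \<le> expectation (stab t)" .
  moreover have "expectation (next_stab t) = expectation (stab (Suc t)) + \<eta>' * expectation (\<lambda>\<omega>. (norm (dx (Suc t) \<omega>))\<^sup>2)
      + C\<^sub>2 * expectation (\<lambda>\<omega>. (norm (dx t \<omega>))\<^sup>2)
      + 1 / (\<sigma> * \<beta>) * expectation (\<lambda>\<omega>. (norm (du (Suc t) \<omega>))\<^sup>2)"
    unfolding next_stab_def[abs_def] using stab_integrable increments_sq_integrable
    by (simp add: sq_integrable_def)
  moreover have "0 \<le> C\<^sub>2 * expectation (\<lambda>\<omega>. (norm (dx t \<omega>))\<^sup>2)"
    using C2_pos by simp
  ultimately show ?thesis
    by linarith
qed

text \<open>The multiplier term of the augmented Lagrangian is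
  \<open>u\<^sub>t \<bullet> (u\<^sub>t - u\<^sub>t\<^sub>-\<^sub>1) / (\<sigma>\<beta>)\<close>, which is bounded below by a telescoping difference.\<close>

lemma stab_ge:
  obtains c where "\<And>t \<omega>. \<omega> \<in> space M \<Longrightarrow>
    c + 1 / (2 * (\<sigma> * \<beta>)) * ((norm (u (Suc t) \<omega>))\<^sup>2 - (norm (u t \<omega>))\<^sup>2) \<le> stab t \<omega>"
proof -
  obtain c1 c2 where c1: "ereal c1 \<le> F y" and c2: "c2 \<le> H y'" for y y'
    using F_bounded H_bounded unfolding bounded_from_below_def by auto
  have "c1 + c2 + 1 / (2 * (\<sigma> * \<beta>)) * ((norm (u (Suc t) \<omega>))\<^sup>2 - (norm (u t \<omega>))\<^sup>2) \<le> stab t \<omega>"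
    if \<omega>: "\<omega> \<in> space M" for t \<omega>
  proof -
    let ?r = "A *v x (Suc t) \<omega> - z (Suc t) \<omega>"
    define k where "k = 1 / (2 * (\<sigma> * \<beta>))"
    have "?r = (2 * k) *\<^sub>R du t \<omega>"
      using update(2)[OF \<omega>, of t] \<sigma>_pos \<beta>_pos by (simp add: du_def k_def)
    then have "u (Suc t) \<omega> \<bullet> ?r = 2 * k * (u (Suc t) \<omega> \<bullet> du t \<omega>)"
      by (simp only: inner_scaleR_right)
    \<comment> \<open>Polarization: twice the inner product of a with a - b is |a|^2 - |b|^2 + |a -
      b|^2.\<close>
    also have "\<dots> = k
        * ((norm (u (Suc t) \<omega>))\<^sup>2 - (norm (u t \<omega>))\<^sup>2 + (norm (du t \<omega>))\<^sup>2)"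
      by (simp add: du_def power2_norm_eq_inner inner_diff_left inner_diff_right inner_commute
          algebra_simps)
    finally have "u (Suc t) \<omega> \<bullet> ?r
        = k * ((norm (u (Suc t) \<omega>))\<^sup>2 - (norm (u t \<omega>))\<^sup>2 + (norm (du t \<omega>))\<^sup>2)" .
    moreover have "c1 \<le> real_of_ereal (F (z (Suc t) \<omega>))"
      using c1[of "z (Suc t) \<omega>"] by (subst (asm) F_z_finite[OF \<omega>]) simp
    moreover have "k * ((norm (u (Suc t) \<omega>))\<^sup>2 - (norm (u t \<omega>))\<^sup>2)
        \<le> k * ((norm (u (Suc t) \<omega>))\<^sup>2 - (norm (u t \<omega>))\<^sup>2 + (norm (du t \<omega>))\<^sup>2)"
      using \<sigma>_pos \<beta>_pos by (intro mult_left_mono) (simp_all add: k_def)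
    moreover have "0 \<le> \<beta> / 2 * (norm ?r)\<^sup>2" "0 \<le> C\<^sub>0 * (norm (w t \<omega>))\<^sup>2"
      "0 \<le> K / \<rho> * Upsilon s v x (Suc t) \<omega>" "0 \<le> 16 * \<kappa> * (norm (err t \<omega>))\<^sup>2"
      "0 \<le> C\<^sub>3 * (norm (dx t \<omega>))\<^sup>2"
      using \<beta>_pos \<kappa>_pos const_nonneg vr_const by (auto simp: Upsilon_def 
          intro!: mult_nonneg_nonneg divide_nonneg_nonneg sum_nonneg)
    ultimately show ?thesis
      using c2[of "x (Suc t) \<omega>"] unfolding stab_def lag_def k_def by linarith
  qed
  then show thesis
    by (rule that)
qed

text \<open>The pathwise bound still contains a difference of multiplier norms of unknown sign.
  Monotonicity of the expectations removes it through telescoping.\<close>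

lemma expectation_stab_ge:
  assumes "0 \<le> \<eta>'"
  obtains c where "\<And>t. c \<le> expectation (stab t)"
proof -
  obtain c where c: "\<And>t \<omega>. \<omega> \<in> space M \<Longrightarrow>
      c + 1 / (2 * (\<sigma> * \<beta>)) * ((norm (u (Suc t) \<omega>))\<^sup>2 - (norm (u t \<omega>))\<^sup>2) \<le> stab t \<omega>"
    using stab_ge by blast
  define b where "b t = expectation (\<lambda>\<omega>. (norm (u t \<omega>))\<^sup>2)" for t
  have "c \<le> expectation (stab t)" for t
  proof (rule telescoping_lower_bound)
    show "decseq (\<lambda>t. expectation (stab t))"
    proof (rule decseq_SucI)
      show "expectation (stab (Suc t)) \<le> expectation (stab t)" for t
      proof -
        have "0 \<le> \<eta>' * expectation (\<lambda>\<omega>. (norm (dx (Suc t) \<omega>))\<^sup>2)"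
          "0 \<le> 1 / (\<sigma> * \<beta>) * expectation (\<lambda>\<omega>. (norm (du (Suc t) \<omega>))\<^sup>2)"
          using assms \<sigma>_pos \<beta>_pos by simp_all
        then show ?thesis
          using stab_expectation_step[of t] by linarith
      qed
    qed
    show "0 \<le> 1 / (2 * (\<sigma> * \<beta>))" "0 \<le> b t" for t
      using \<sigma>_pos \<beta>_pos by (simp_all add: b_def)
    show "1 / (2 * (\<sigma> * \<beta>)) * (b (Suc t) - b t) \<le> expectation (stab t) - c" for t
    proof -
      have u: "integrable M (\<lambda>\<omega>. (norm (u t \<omega>))\<^sup>2)" for t
        using u_sq_integrable by (simp add: sq_integrable_def)
      then have "expectation (\<lambda>\<omega>. c + 1 / (2 * (\<sigma> * \<beta>)) * ((norm (u (Suc t) \<omega>))\<^sup>2 - (norm (u t \<omega>))\<^sup>2))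
          \<le> expectation (stab t)"
        using stab_integrable c by (intro integral_mono) auto
      then show ?thesis
        using u by (simp add: b_def prob_space)
    qed
  qed
  then show thesis
    by (rule that)
qed

lemma summable_increments:
  assumes "0 < \<eta>'"
  shows "summable (\<lambda>t. expectation (\<lambda>\<omega>. (norm (dx t \<omega>))\<^sup>2))" (is "summable ?X")
    and "summable (\<lambda>t. expectation (\<lambda>\<omega>. (norm (du t \<omega>))\<^sup>2))" (is "summable ?U")
proof -
  obtain c where c: "\<And>t. c \<le> expectation (stab t)"
    using expectation_stab_ge assms by (meson less_imp_le)
  let ?f = "\<lambda>t. \<eta>' * ?X (Suc t) + 1 / (\<sigma> * \<beta>) * ?U (Suc t)"
  have X: "0 \<le> \<eta>' * ?X (Suc t)" and U: "0 \<le> 1 / (\<sigma> * \<beta>) * ?U (Suc t)" for t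
    using assms \<sigma>_pos \<beta>_pos by simp_all
  have "(\<Sum>t<n. ?f t) \<le> expectation (stab 0) - expectation (stab n)" for n
  proof (induction n)
    case (Suc n)
    then show ?case
      using stab_expectation_step[of n] by simp
  qed simp
  then have "(\<Sum>t<n. ?f t) \<le> expectation (stab 0) - c" for n
    using c[of n] by (meson diff_left_mono order_trans)
  then have f: "summable ?f"
    using X U by (intro summableI_nonneg_bounded[of ?f]) auto
  have "summable (\<lambda>t. \<eta>' * ?X (Suc t))" "summable (\<lambda>t. 1 / (\<sigma> * \<beta>) * ?U (Suc t))"
    by (rule summable_comparison_test'[OF f, of 0],
        use X U in \<open>simp only: real_norm_def abs_of_nonneg add_increasing add_increasing2 order_refl\<close>)+
  then have "summable (\<lambda>t. ?X (Suc t))" "summable (\<lambda>t. ?U (Suc t))"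
    using assms \<sigma>_pos \<beta>_pos by simp_all
  \<comment> \<open>The descent controls increments from index 1 on; adding the finite term at 0
    does not affect summability.\<close>
  then show "summable ?X" "summable ?U"
    by (simp_all only: summable_Suc_iff[of ?X] summable_Suc_iff[of ?U])
qed

text \<open>The dual update expresses each updated z as Ax minus a multiple of the multiplier
  increment, so dz is controlled by dx and two consecutive du. The initial z satisfies no such
  relation, hence the index shift.\<close>

lemma summable_dz:
  assumes "0 < \<eta>'"
  shows "summable (\<lambda>t. expectation (\<lambda>\<omega>. (norm (dz t \<omega>))\<^sup>2))" (is "summable ?Z")
proof -
  let ?X = "\<lambda>t. expectation (\<lambda>\<omega>. (norm (dx t \<omega>))\<^sup>2)" and ?U = "\<lambda>t. expectation (\<lambda>\<omega>. (norm (du t \<omega>))\<^sup>2)"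
  define k where "k = 1 / (\<sigma> * \<beta>)"
  define n where "n = onorm ((*v) A)"
  let ?b = "\<lambda>t. 2 * n\<^sup>2 * ?X (Suc t) + 4 * k\<^sup>2 * (?U (Suc t) + ?U t)"
  have le: "?Z (Suc t) \<le> ?b t" for t
  proof -
    have sq: "integrable M (\<lambda>\<omega>. (norm (dx t \<omega>))\<^sup>2)" "integrable M (\<lambda>\<omega>. (norm (du t \<omega>))\<^sup>2)"
      "integrable M (\<lambda>\<omega>. (norm (dz t \<omega>))\<^sup>2)" for t
      using increments_sq_integrable by (auto simp: sq_integrable_def)
    have "(norm (dz (Suc t) \<omega>))\<^sup>2
      \<le> 2 * n\<^sup>2 * (norm (dx (Suc t) \<omega>))\<^sup>2 + 4 * k\<^sup>2 * ((norm (du (Suc t) \<omega>))\<^sup>2 + (norm (du t \<omega>))\<^sup>2)"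
      if \<omega>: "\<omega> \<in> space M" for \<omega>
    proof -
      have "z (Suc t) \<omega> = A *v x (Suc t) \<omega> - k *\<^sub>R du t \<omega>" for t
        using update(2)[OF \<omega>, of t] \<sigma>_pos \<beta>_pos by (simp add: du_def k_def)
      then have dz: "dz (Suc t) \<omega> = A *v dx (Suc t) \<omega> - k *\<^sub>R (du (Suc t) \<omega> - du t \<omega>)"
        by (simp add: dz_def dx_def matrix_vector_mult_diff_distrib algebra_simps)
      have "(norm (A *v dx (Suc t) \<omega>))\<^sup>2 \<le> n\<^sup>2 * (norm (dx (Suc t) \<omega>))\<^sup>2"
        unfolding power_mult_distrib[symmetric] n_def by (intro power_mono onorm) auto
      moreover have "(norm (k *\<^sub>R (du (Suc t) \<omega> - du t \<omega>)))\<^sup>2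
          \<le> k\<^sup>2 * (2 * (norm (du (Suc t) \<omega>))\<^sup>2 + 2 * (norm (du t \<omega>))\<^sup>2)"
        unfolding norm_scaleR power_mult_distrib power2_abs by (intro mult_left_mono norm_diff_sq_le) simp
      ultimately show ?thesis
        unfolding dz using norm_diff_sq_le[of "A *v dx (Suc t) \<omega>" "k *\<^sub>R (du (Suc t) \<omega> - du t \<omega>)"]
        by (simp add: algebra_simps)
    qed
    then have "?Z (Suc t) \<le> expectation (\<lambda>\<omega>. 2 * n\<^sup>2 * (norm (dx (Suc t) \<omega>))\<^sup>2
        + 4 * k\<^sup>2 * ((norm (du (Suc t) \<omega>))\<^sup>2 + (norm (du t \<omega>))\<^sup>2))"
      using sq by (intro integral_mono) auto
    then show ?thesis
      using sq by simp
  qed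
  have "summable ?b"
    using summable_increments[OF assms] summable_increments[OF assms, THEN summable_Suc_iff[THEN iffD2]]
    by (intro summable_add summable_mult)
  then have "summable (\<lambda>t. ?Z (Suc t))"
    by (rule summable_comparison_test') (use le in \<open>simp add: abs_of_nonneg\<close>)
  then show ?thesis
    by (simp only: summable_Suc_iff[of ?Z])
qed

lemma suminf_increments_finite:
  assumes "0 < \<eta>'"
  shows "(\<Sum>t. \<integral>\<^sup>+\<omega>. ennreal ((norm (dx t \<omega>))\<^sup>2 + (norm (du t \<omega>))\<^sup>2 + (norm (dz t \<omega>))\<^sup>2) \<partial>M) < \<infinity>"
proof -
  let ?f = "\<lambda>t \<omega>. (norm (dx t \<omega>))\<^sup>2 + (norm (du t \<omega>))\<^sup>2 + (norm (dz t \<omega>))\<^sup>2"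
  have sq: "integrable M (\<lambda>\<omega>. (norm (dx t \<omega>))\<^sup>2)" "integrable M (\<lambda>\<omega>. (norm (du t \<omega>))\<^sup>2)"
      "integrable M (\<lambda>\<omega>. (norm (dz t \<omega>))\<^sup>2)" for t
    using increments_sq_integrable by (auto simp: sq_integrable_def)
  then have "(\<integral>\<^sup>+\<omega>. ennreal (?f t \<omega>) \<partial>M) = ennreal (expectation (?f t))" for t
    by (intro nn_integral_eq_integral) auto
  moreover have "summable (\<lambda>t. expectation (?f t))"
    using summable_add[OF summable_add[OF summable_increments[OF assms]] summable_dz[OF assms]] sq
    by simp
  ultimately show ?thesis
    by (simp add: suminf_ennreal2)
qed

end

section \<open>Transfer of the estimates to the extended-valued stability function\<close>

theorem theorem3p2:
  fixes M :: "'w measure" and Fil :: "nat \<Rightarrow> 'w measure"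
    and F :: "real^'m \<Rightarrow> ereal" and H :: "real^'d \<Rightarrow> real"
    and Hs :: "nat \<Rightarrow> real^'d \<Rightarrow> real" and n :: nat and L :: real
    and A :: "real^'d^'m" and B :: "real^'d^'d"
    and \<beta> \<tau> \<sigma> \<eta> \<eta>' \<mu>\<^sub>m C\<^sub>0 C\<^sub>1 C\<^sub>2 C\<^sub>3 :: real
    and V\<^sub>1 V\<^sub>2 V\<^sub>\<Upsilon> \<rho> :: real
    and g :: "nat \<Rightarrow> ('w, real^'d, real^'d) process_map"
    and s :: nat and v :: "nat \<Rightarrow> nat \<Rightarrow> ('w, real^'d, 'v::euclidean_space) process_map"
    and x :: "nat \<Rightarrow> 'w \<Rightarrow> real^'d" and z u :: "nat \<Rightarrow> 'w \<Rightarrow> real^'m"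
    and \<Psi> :: "nat \<Rightarrow> 'w \<Rightarrow> ereal"
  assumes "prob_space M" and "filtration (space M) Fil" and "\<And>t. subalgebra M (Fil t)"
    and "n \<ge> 1" and "\<And>a. H a = (1 / real n) * (\<Sum>i=1..n. Hs i a)"
    and "proper_fun F" and "lower_semicont F" and "bounded_from_below F"
    and "proper_fun (\<lambda>a. ereal (H a))" and "lower_semicont (\<lambda>a. ereal (H a))"
    and "bounded_from_below (\<lambda>a. ereal (H a))"
    and "surj ((*v) A)"
    and "L > 0"
    and "\<And>i a. i \<in> {1..n} \<Longrightarrow> Hs i differentiable (at a)"
    and "\<And>i a b. i \<in> {1..n} \<Longrightarrow> norm (grad (Hs i) a - grad (Hs i) b) \<le> L * norm (a - b)"
    and "\<beta> > 0" and "\<tau> > 0" and "0 < \<sigma>" and "\<sigma> \<le> 1" and "2 * \<tau> \<ge> \<beta> * (onorm ((*v) A))\<^sup>2"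
    and "stochastic_admm M Fil F A \<beta> \<tau> \<sigma> g x z u"
    and "variance_reduced M Fil H g s v V\<^sub>1 V\<^sub>2 V\<^sub>\<Upsilon> \<rho> x"
    and "\<eta> > 0" and "C\<^sub>2 > 0"
    and "\<mu>\<^sub>m = smallest_eigenvalue (A ** transpose A)"
    and "B = \<tau> *\<^sub>R mat 1 - \<beta> *\<^sub>R (transpose A ** A)"
    and "C\<^sub>0 = 4 * (1 - \<sigma>) / (\<sigma>\<^sup>2 * \<beta> * \<mu>\<^sub>m)"
    and "C\<^sub>1 = 8 * (\<sigma> * \<tau> + L)\<^sup>2 / (\<sigma> * \<beta> * \<mu>\<^sub>m)"
    and "C\<^sub>3 = (32 / (\<sigma> * \<beta> * \<mu>\<^sub>m) + \<eta> / 2) * (V\<^sub>1 + V\<^sub>\<Upsilon> / \<rho>) + C\<^sub>2 + C\<^sub>1"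
    and "\<And>t \<omega>. t \<ge> 1 \<Longrightarrow>
          \<Psi> t \<omega> = aug_lagrangian F H A \<beta> (x t \<omega>) (z t \<omega>) (u t \<omega>)
            + ereal (C\<^sub>0 * (norm (transpose A *v (u t \<omega> - u (t - 1) \<omega>)
                               + \<sigma> *\<^sub>R (B *v (x t \<omega> - x (t - 1) \<omega>))))\<^sup>2
                   + (1 / \<rho>) * (32 / (\<sigma> * \<beta> * \<mu>\<^sub>m) + \<eta> / 2) * Upsilon s v x t \<omega>
                   + 16 / (\<sigma> * \<beta> * \<mu>\<^sub>m) * (norm (g (t - 1) x \<omega> - grad H (x (t - 1) \<omega>)))\<^sup>2
                   + C\<^sub>3 * (norm (x t \<omega> - x (t - 1) \<omega>))\<^sup>2)"
    and "\<eta>' = \<tau> - (L + \<beta> * (onorm ((*v) A))\<^sup>2) / 2 - 4 * \<sigma> * \<tau>\<^sup>2 / (\<beta> * \<mu>\<^sub>m)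
              - 8 * (\<sigma> * \<tau> + L)\<^sup>2 / (\<sigma> * \<beta> * \<mu>\<^sub>m) - 1 / (2 * \<eta>)
              - (64 / (\<sigma> * \<beta> * \<mu>\<^sub>m) + \<eta>) * (V\<^sub>1 + V\<^sub>\<Upsilon> / \<rho>) - C\<^sub>2"
  shows "(\<forall>t\<ge>1.
            let D = (\<lambda>\<omega>. real_of_ereal (\<Psi> (t + 1) \<omega>)
                      + \<eta>' * (norm (x (t + 1) \<omega> - x t \<omega>))\<^sup>2
                      + C\<^sub>2 * (norm (x t \<omega> - x (t - 1) \<omega>))\<^sup>2
                      + 1 / (\<sigma> * \<beta>) * (norm (u (t + 1) \<omega> - u t \<omega>))\<^sup>2)
            in (\<forall>\<omega>\<in>space M. \<bar>\<Psi> t \<omega>\<bar> \<noteq> \<infinity>) \<and> integrable M D \<and>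
               (AE \<omega> in M. ereal (real_cond_exp M (Fil t) D \<omega>) \<le> \<Psi> t \<omega>))
         \<and> (\<eta>' > 0 \<longrightarrow>
             (\<Sum>t. \<integral>\<^sup>+\<omega>. ennreal ((norm (x (t + 1) \<omega> - x t \<omega>))\<^sup>2
                                 + (norm (u (t + 1) \<omega> - u t \<omega>))\<^sup>2
                                 + (norm (z (t + 1) \<omega> - z t \<omega>))\<^sup>2) \<partial>M) < \<infinity>)"
proof -
  have H_deriv: "GDERIV H a :> grad H a" for a
  proof -
    have "GDERIV H a :> (1 / real n) *\<^sub>R (\<Sum>i=1..n. grad (Hs i) a)"
      by (rule GDERIV_average) (use assms(5,14) in blast)+
    then show ?thesis
      using grad_eqI by metis
  qed
  interpret R: stochastic_admm_run M Fil F H L A \<beta> \<tau> \<sigma> \<eta> C\<^sub>2 V\<^sub>1 V\<^sub>2 V\<^sub>\<Upsilon> \<rho> g s v x z u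
    using assms H_deriv grad_average_Lipschitz[of n Hs L H]
    by (intro stochastic_admm_run.intro stochastic_admm_run_axioms.intro) auto
  have \<mu>: "\<mu>\<^sub>m = R.\<mu>" and B: "B = R.B"
    using assms by (simp_all add: R.\<mu>_def R.B_def)
  have K: "32 / (\<sigma> * \<beta> * \<mu>\<^sub>m) + \<eta> / 2 = R.K" and \<kappa>: "16 / (\<sigma> * \<beta> * \<mu>\<^sub>m) = 16 * R.\<kappa>"
    and C\<^sub>0: "C\<^sub>0 = R.C\<^sub>0" and C\<^sub>1: "C\<^sub>1 = R.C\<^sub>1"
    using assms by (simp_all add: R.K_def R.\<kappa>_def R.C\<^sub>0_def R.C\<^sub>1_def \<mu>)
  have C\<^sub>3: "C\<^sub>3 = R.C\<^sub>3"
    using assms K C\<^sub>1 by (simp add: R.C\<^sub>3_def)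
  have "64 / (\<sigma> * \<beta> * \<mu>\<^sub>m) + \<eta> = 2 * R.K"
    by (simp flip: K)
  then have \<eta>': "\<eta>' = R.\<eta>'"
    using assms C\<^sub>1 \<mu> by (simp add: R.\<eta>'_def R.a_def)
  \<comment> \<open>The shifted index guarantees that the z-iterate inside is a minimiser, so the
    extended value is an honest real.\<close>
  have stab: "\<Psi> (Suc k) \<omega> = ereal (R.stab k \<omega>)" if "\<omega> \<in> space M" for k \<omega>
  proof -
    have "aug_lagrangian F H A \<beta> (x (Suc k) \<omega>) (z (Suc k) \<omega>) (u (Suc k) \<omega>) = ereal (R.lag (Suc k) \<omega>)"
      unfolding aug_lagrangian_def R.lag_def by (subst R.F_z_finite[OF that]) (simp add: add.assoc)
    then show ?thesis
      using assms(30)[of "Suc k" \<omega>] unfolding K \<kappa> C\<^sub>0 C\<^sub>3 B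
      by (simp add: R.stab_def R.w_def R.dx_def R.du_def R.err_def add.assoc)
  qed
  show ?thesis
  proof (intro conjI impI allI)
    fix t :: nat assume "t \<ge> 1"
    then obtain k where t: "t = Suc k"
      using Suc_le_D by auto
    define D where "D \<omega> = real_of_ereal (\<Psi> (t + 1) \<omega>)
                      + \<eta>' * (norm (x (t + 1) \<omega> - x t \<omega>))\<^sup>2
                      + C\<^sub>2 * (norm (x t \<omega> - x (t - 1) \<omega>))\<^sup>2
                      + 1 / (\<sigma> * \<beta>) * (norm (u (t + 1) \<omega> - u t \<omega>))\<^sup>2" for \<omega>
    have D: "D \<omega> = R.next_stab k \<omega>" if "\<omega> \<in> space M" for \<omega>
      using stab[OF that, of "Suc k"]
      by (simp add: D_def t R.next_stab_def R.dx_def R.du_def \<eta>')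
    then have int: "integrable M D"
      using R.next_stab_integrable[of k] Bochner_Integration.integrable_cong[of M M D] by blast
    \<comment> \<open>\<open>D\<close> and \<open>R.next_stab k\<close> are identified on the sample
      space only, which suffices for their conditional expectations to agree almost
      everywhere.\<close>
    have "AE \<omega> in M. real_cond_exp M (Fil t) D \<omega> = real_cond_exp M (Fil t) (R.next_stab k) \<omega>"
      using D int R.next_stab_integrable[of k] by (intro R.real_cond_exp_cong AE_I2) auto
    then have "AE \<omega> in M. ereal (real_cond_exp M (Fil t) D \<omega>) \<le> \<Psi> t \<omega>"
      using R.stab_step[of k] AE_space
      by eventually_elim (simp add: t stab)
    then show "let D = (\<lambda>\<omega>. real_of_ereal (\<Psi> (t + 1) \<omega>)
                      + \<eta>' * (norm (x (t + 1) \<omega> - x t \<omega>))\<^sup>2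
                      + C\<^sub>2 * (norm (x t \<omega> - x (t - 1) \<omega>))\<^sup>2
                      + 1 / (\<sigma> * \<beta>) * (norm (u (t + 1) \<omega> - u t \<omega>))\<^sup>2)
            in (\<forall>\<omega>\<in>space M. \<bar>\<Psi> t \<omega>\<bar> \<noteq> \<infinity>) \<and> integrable M D \<and>
               (AE \<omega> in M. ereal (real_cond_exp M (Fil t) D \<omega>) \<le> \<Psi> t \<omega>)"
      using int stab unfolding Let_def D_def[abs_def] by (simp add: t)
  next
    assume "\<eta>' > 0"
    then show "(\<Sum>t. \<integral>\<^sup>+\<omega>. ennreal ((norm (x (t + 1) \<omega> - x t \<omega>))\<^sup>2
                                 + (norm (u (t + 1) \<omega> - u t \<omega>))\<^sup>2
                                 + (norm (z (t + 1) \<omega> - z t \<omega>))\<^sup>2) \<partial>M) < \<infinity>"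
      using R.suminf_increments_finite by (simp add: \<eta>' R.dx_def R.du_def R.dz_def)
  qed
qed

end
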